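(* Let $\mathbb K$ be a field, $X$ a finite set, $G$ a permutation groupoid on $X$, and $<$ any admissible term order on the monomials of $\mathbb K[X]$. Then the invariant ring $\mathbb K[X]^G$ has a finite SAGBI basis with respect to $<$ if and only if $G={\downarrow}H$ for some permutation group $H$ on $X$ generated by transpositions.
   Context: A local bijection of $X$ is a bijection $f:\operatorname{dom}f\to\operatorname{im}f$ between subsets of $X$. A permutation groupoid on $X$ is a set $G$ of local bijections containing the identity of $X$ and closed under restriction to subsets of the domain, inverses, and composition $f\circ g$ whenever $\operatorname{im}g=\operatorname{dom}f$. For a permutation group $H$ on $X$, ${\downarrow}H$ denotes the permutation groupoid of all restrictions of elements of $H$ to subsets of $X$. For $f\in G$ and a monomial $x^d=\prod x_i^{d_i}$ with support contained in $\operatorname{dom}f$, $f.x^d=\prod_{d_i>0}x_{f(i)}^{d_i}$; the invariant ring $\mathbb K[X]^G$ is the span of the orbit sums (sum of all monomials $f.x^d$, $f\in G$, in the orbit of a monomial $x^d$). An admissible term order is a total order on monomials compatible with multiplication and having $1$ as least element. For a subalgebra $A$ of $\mathbb K[X]$, a SAGBI basis of $A$ with respect to $<$ is a subset $B\subseteq A$ such that the initial (leading) monomials of elements of $B$ generate, as a monoid, the monoid of initial monomials of all nonzero elements of $A$. *)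

theory Defs
  imports
    Complex_Main
    "HOL-Library.Poly_Mapping"
    "HOL-Combinatorics.Transposition"
    "HOL-Algebra.Bij"
    "HOL-Algebra.Generated_Groups"
begin

section \<open>Permutation groupoids\<close>

text \<open>
  A local bijection \<open>f\<close> is a partial map with domain \<open>dom f\<close> and image \<open>ran f\<close>.
\<close>

definition local_bijection :: "'a set \<Rightarrow> ('a \<rightharpoonup> 'a) \<Rightarrow> bool" where
  "local_bijection X f \<longleftrightarrow> dom f \<subseteq> X \<and> ran f \<subseteq> X \<and> inj_on f (dom f)"

definition local_inverse :: "('a \<rightharpoonup> 'a) \<Rightarrow> ('a \<rightharpoonup> 'a)" where
  "local_inverse f = (\<lambda>y. if y \<in> ran f then Some (THE x. f x = Some y) else None)"

definition permutation_groupoid :: "'a set \<Rightarrow> ('a \<rightharpoonup> 'a) set \<Rightarrow> bool" where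
  "permutation_groupoid X G \<longleftrightarrow>
     (\<forall>f\<in>G. local_bijection X f) \<and>
     Some |` X \<in> G \<and>
     (\<forall>f\<in>G. \<forall>Y. Y \<subseteq> dom f \<longrightarrow> f |` Y \<in> G) \<and>
     (\<forall>f\<in>G. local_inverse f \<in> G) \<and>
     (\<forall>f\<in>G. \<forall>g\<in>G. ran g = dom f \<longrightarrow> f \<circ>\<^sub>m g \<in> G)"

text \<open>
  Permutation groups on \<open>X\<close> are subgroups of \<^const>\<open>BijGroup\<close>, whose elements are extensional
  functions; hence transpositions have to be restricted to \<open>X\<close>.
\<close>

definition restrictions :: "'a set \<Rightarrow> ('a \<Rightarrow> 'a) set \<Rightarrow> ('a \<rightharpoonup> 'a) set" where
  "restrictions X H = {(Some \<circ> h) |` Y | h Y. h \<in> H \<and> Y \<subseteq> X}"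

definition transpositions :: "'a set \<Rightarrow> ('a \<Rightarrow> 'a) set" where
  "transpositions X =
     {restrict (Transposition.transpose a b) X | a b. a \<in> X \<and> b \<in> X \<and> a \<noteq> b}"

definition generated_by_transpositions :: "'a set \<Rightarrow> ('a \<Rightarrow> 'a) set \<Rightarrow> bool" where
  "generated_by_transpositions X H \<longleftrightarrow>
     (\<exists>T\<subseteq>transpositions X. H = generate (BijGroup X) T)"


section \<open>Invariant rings\<close>

text \<open>
  Monomials are exponent vectors, so that multiplication of monomials is addition and the
  monomial 1 is \<open>0\<close>. Since \<open>X\<close> is a set rather than a type, the monomials of
  \<open>K[X]\<close> are those supported in \<open>X\<close>.
\<close>

type_synonym 'a monomial = "'a \<Rightarrow>\<^sub>0 nat"

type_synonym ('a, 'k) mpoly = "('a \<Rightarrow>\<^sub>0 nat) \<Rightarrow>\<^sub>0 'k"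

definition monomials :: "'a set \<Rightarrow> 'a monomial set" where
  "monomials X = {d. Poly_Mapping.keys d \<subseteq> X}"

definition scale :: "'k::field \<Rightarrow> ('a, 'k) mpoly \<Rightarrow> ('a, 'k) mpoly" where
  "scale c p = Poly_Mapping.single 0 c * p"

lemma vector_space_scale: "vector_space (scale :: 'k::field \<Rightarrow> ('a, 'k) mpoly \<Rightarrow> ('a, 'k) mpoly)"
proof
  fix a b :: 'k and p q :: "('a, 'k) mpoly"
  show "scale a (p + q) = scale a p + scale a q"
    by (simp add: scale_def distrib_left)
  show "scale (a + b) p = scale a p + scale b p"
    by (simp add: scale_def single_add distrib_right)
  show "scale a (scale b p) = scale (a * b) p"
    by (simp add: scale_def mult_single flip: mult.assoc)
  show "scale 1 p = p"
    by (simp add: scale_def)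
qed

definition act :: "('a \<rightharpoonup> 'a) \<Rightarrow> 'a monomial \<Rightarrow> 'a monomial" where
  "act f d =
     (\<Sum>i\<in>Poly_Mapping.keys d. Poly_Mapping.single (the (f i)) (Poly_Mapping.lookup d i))"

definition orbit :: "('a \<rightharpoonup> 'a) set \<Rightarrow> 'a monomial \<Rightarrow> 'a monomial set" where
  "orbit G d = {act f d | f. f \<in> G \<and> Poly_Mapping.keys d \<subseteq> dom f}"

definition orbit_sum :: "('a \<rightharpoonup> 'a) set \<Rightarrow> 'a monomial \<Rightarrow> ('a, 'k::field) mpoly" where
  "orbit_sum G d = (\<Sum>m\<in>orbit G d. Poly_Mapping.single m 1)"

definition invariant_ring :: "'a set \<Rightarrow> ('a \<rightharpoonup> 'a) set \<Rightarrow> ('a, 'k::field) mpoly set" where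
  "invariant_ring X G = module.span scale (orbit_sum G ` monomials X)"


section \<open>SAGBI bases\<close>

text \<open>
  A term order is given by its reflexive version. As addition of exponent vectors is
  cancellative, monotonicity of the reflexive order yields that of the strict one.
\<close>

definition admissible_order :: "'a set \<Rightarrow> 'a monomial rel \<Rightarrow> bool" where
  "admissible_order X r \<longleftrightarrow>
     linear_order_on (monomials X) r \<and>
     (\<forall>s t. \<forall>u\<in>monomials X. (s, t) \<in> r \<longrightarrow> (s + u, t + u) \<in> r) \<and>
     (\<forall>t\<in>monomials X. (0, t) \<in> r)"

text \<open>The initial monomial is only meaningful for nonzero polynomials.\<close>

definition initial :: "'a monomial rel \<Rightarrow> ('a, 'k::field) mpoly \<Rightarrow> 'a monomial" where
  "initial r p = (THE m. m \<in> Poly_Mapping.keys p \<and> (\<forall>s\<in>Poly_Mapping.keys p. (s, m) \<in> r))"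

definition initials :: "'a monomial rel \<Rightarrow> ('a, 'k::field) mpoly set \<Rightarrow> 'a monomial set" where
  "initials r A = {initial r p | p. p \<in> A \<and> p \<noteq> 0}"

inductive_set monoid_generated :: "'m::monoid_add set \<Rightarrow> 'm set" for S where
  zero: "0 \<in> monoid_generated S"
| base: "s \<in> S \<Longrightarrow> s \<in> monoid_generated S"
| add: "s \<in> monoid_generated S \<Longrightarrow> t \<in> monoid_generated S \<Longrightarrow> s + t \<in> monoid_generated S"

definition sagbi_basis ::
    "'a monomial rel \<Rightarrow> ('a, 'k::field) mpoly set \<Rightarrow> ('a, 'k) mpoly set \<Rightarrow> bool" where
  "sagbi_basis r A B \<longleftrightarrow> B \<subseteq> A \<and> monoid_generated (initials r B) = initials r A"

end

theory Submission
  imports Defs "HOL-Library.Multiset"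
begin

text \<open>
  The initial monomials of the invariant ring are the monomials that are maximal in their orbit.
  They form a monoid \<open>M\<close>, and a finite SAGBI basis exists iff \<open>M\<close> is finitely generated.

  If \<open>G\<close> comes from a group generated by transpositions, then \<open>M\<close> consists of the monomials whose
  exponents are sorted within each orbit of variables, and splitting off the support again and
  again writes such a monomial as a product of squarefree ones in \<open>M\<close>.

  Conversely, let \<open>M\<close> be finitely generated.  By Dickson's lemma, applied to the exponents of the
  generators, the cone spanned by \<open>M\<close> is closed.  Hence every monomial is made maximal by a
  permutation in \<open>G\<close> of all of \<open>X\<close>, which shows that \<open>G\<close> consists of restrictions of such
  permutations.  Moving from a monomial \<open>p\<close> with distinct exponents towards (a power of) \<open>k.p\<close> by
  changing one exponent at a time, at most two exponents coincide at any point, so a permutation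
  in \<open>G\<close> that fixes a monomial on the path is a transposition or the identity.  The permutations
  making the points maximal therefore stay in one coset of the group generated by the
  transpositions in \<open>G\<close>, and comparing the two endpoints puts \<open>k\<close> into that group.
\<close>

section \<open>Sums over multisets, Dickson's lemma and maxima of finite sets\<close>

text \<open>The multiset records how often each generator occurs in a product; these multiplicities
  are what Dickson's lemma compares in \<open>good_pair\<close>.\<close>

lemma mem_monoid_generated_iff:
  fixes S :: "'m::comm_monoid_add set"
  shows "x \<in> monoid_generated S \<longleftrightarrow> (\<exists>N. set_mset N \<subseteq> S \<and> x = \<Sum>\<^sub># N)"
proof
  assume "x \<in> monoid_generated S"
  then show "\<exists>N. set_mset N \<subseteq> S \<and> x = \<Sum>\<^sub># N"
  proof induction
    case zero
    show ?case by (rule exI[of _ "{#}"]) simp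
  next
    case (base s)
    then show ?case by (intro exI[of _ "{#s#}"]) simp
  next
    case (add s t)
    then obtain N N' where "set_mset N \<subseteq> S" "s = \<Sum>\<^sub># N" "set_mset N' \<subseteq> S" "t = \<Sum>\<^sub># N'"
      by blast
    then show ?case by (intro exI[of _ "N + N'"]) simp
  qed
next
  assume "\<exists>N. set_mset N \<subseteq> S \<and> x = \<Sum>\<^sub># N"
  then obtain N where "set_mset N \<subseteq> S" "x = \<Sum>\<^sub># N" by blast
  then show "x \<in> monoid_generated S"
  proof (induction N arbitrary: x)
    case empty
    then show ?case by (simp add: monoid_generated.zero)
  next
    case (add s N)
    then show ?case by (auto intro: monoid_generated.intros)
  qed
qed

text \<open>Every sequence has a monotone subsequence, and a decreasing one in the naturals stays
  constant once it has reached its least value.\<close>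

lemma nat_seq_mono_subseq:
  fixes f :: "nat \<Rightarrow> nat"
  obtains \<phi> :: "nat \<Rightarrow> nat" where "strict_mono \<phi>" "mono (f \<circ> \<phi>)"
proof -
  obtain \<psi> :: "nat \<Rightarrow> nat" where \<psi>: "strict_mono \<psi>" "monoseq (\<lambda>n. f (\<psi> n))"
    using seq_monosub[of f] by auto
  show thesis
  proof (cases "incseq (\<lambda>n. f (\<psi> n))")
    case True
    then show thesis using that[of \<psi>] \<psi> by (simp add: comp_def)
  next
    case False
    then have dec: "decseq (\<lambda>n. f (\<psi> n))" using \<psi>(2) by (simp add: monoseq_iff)
    define v where "v = (LEAST v. \<exists>n. v = f (\<psi> n))"
    have "\<exists>n. v = f (\<psi> n)" unfolding v_def by (rule LeastI) blast
    then obtain N where N: "v = f (\<psi> N)" by blast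
    have "v \<le> f (\<psi> n)" for n unfolding v_def by (rule Least_le) blast
    then have const: "f (\<psi> (N + n)) = v" for n
      using dec N by (metis decseqD le_add1 le_antisym)
    show thesis
    proof (rule that[of "\<lambda>n. \<psi> (N + n)"])
      show "strict_mono (\<lambda>n. \<psi> (N + n))" using \<psi>(1) by (simp add: strict_mono_def)
      show "mono (f \<circ> (\<lambda>n. \<psi> (N + n)))" using const by (simp add: mono_def)
    qed
  qed
qed

text \<open>The functions are treated one after the other, each time thinning out the indices
  further; monotonicity already obtained survives passing to a subsequence. When \<open>F\<close>
  consists of the coordinates of a sequence of exponent vectors, this is the usual form of Dickson's
  lemma.\<close>

lemma dickson:
  fixes F :: "(nat \<Rightarrow> nat) set"
  assumes "finite F"
  shows "\<exists>\<phi>::nat \<Rightarrow> nat. strict_mono \<phi> \<and> (\<forall>f\<in>F. mono (f \<circ> \<phi>))"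
  using assms
proof induction
  case empty
  show ?case by (auto intro: exI[of _ id] simp: strict_mono_def)
next
  case (insert f F)
  then obtain \<phi> :: "nat \<Rightarrow> nat" where \<phi>: "strict_mono \<phi>" "\<forall>f\<in>F. mono (f \<circ> \<phi>)" by blast
  obtain \<psi> :: "nat \<Rightarrow> nat" where \<psi>: "strict_mono \<psi>" "mono (f \<circ> \<phi> \<circ> \<psi>)"
    by (rule nat_seq_mono_subseq)
  have "strict_mono (\<phi> \<circ> \<psi>)" using \<phi>(1) \<psi>(1) by (rule strict_mono_o)
  moreover have "mono (g \<circ> (\<phi> \<circ> \<psi>))" if "g \<in> F" for g
  proof -
    have "mono (g \<circ> \<phi>)" using \<phi> that by blast
    then show ?thesis using strict_mono_mono[OF \<psi>(1)] by (simp add: mono_def)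
  qed
  moreover have "mono (f \<circ> (\<phi> \<circ> \<psi>))" using \<psi>(2) by (simp only: comp_assoc)
  ultimately show ?case by blast
qed

lemma linear_order_on_finite_has_max:
  assumes "linear_order_on A r" "finite S" "S \<noteq> {}" "S \<subseteq> A"
  shows "\<exists>m\<in>S. \<forall>s\<in>S. (s, m) \<in> r"
  using assms(2-)
proof (induction rule: finite_ne_induct)
  case (singleton x)
  then show ?case using assms(1) by (auto simp: order_on_defs refl_on_def)
next
  case (insert x S)
  then obtain m where m: "m \<in> S" "\<forall>s\<in>S. (s, m) \<in> r" by auto
  have A: "x \<in> A" "m \<in> A" using insert m by auto
  show ?case
  proof (cases "(x, m) \<in> r")
    case True
    then show ?thesis using m by auto
  next
    case False
    then have *: "(m, x) \<in> r" "(x, x) \<in> r"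
      using A assms(1) m insert by (auto simp: order_on_defs refl_on_def total_on_def)
    have "trans r" using assms(1) by (auto simp: order_on_defs)
    then have "\<forall>s\<in>S. (s, x) \<in> r" using m * by (blast dest: transD)
    then show ?thesis using * by auto
  qed
qed

section \<open>Orbits of monomials\<close>

text \<open>Injectivity leaves at most one summand over \<open>j\<close>. The variable
  \<open>i\<close> may lie outside the support; then both sides are 0.\<close>

lemma lookup_act:
  assumes "inj_on f (dom f)" "Poly_Mapping.keys d \<subseteq> dom f" "f i = Some j"
  shows "Poly_Mapping.lookup (act f d) j = Poly_Mapping.lookup d i"
proof -
  have "k = i" if k: "k \<in> Poly_Mapping.keys d" "the (f k) = j" for k
  proof -
    obtain j' where "f k = Some j'" using k(1) assms(2) by blast
    then have "f k = f i" "k \<in> dom f" "i \<in> dom f" using k(2) assms(3) by auto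
    then show "k = i" using assms(1) by (simp add: inj_on_eq_iff)
  qed
  then have "the (f k) = j \<longleftrightarrow> k = i" if "k \<in> Poly_Mapping.keys d" for k
    using that assms(3) by (metis option.sel)
  then have "Poly_Mapping.lookup (act f d) j
      = (\<Sum>k\<in>Poly_Mapping.keys d. if k = i then Poly_Mapping.lookup d i else 0)"
    unfolding act_def lookup_sum by (intro sum.cong refl) (simp add: lookup_single when_def)
  also have "\<dots> = Poly_Mapping.lookup d i"
    by (simp add: in_keys_iff)
  finally show ?thesis .
qed

lemma lookup_act_outside:
  assumes "Poly_Mapping.keys d \<subseteq> dom f" "j \<notin> ran f"
  shows "Poly_Mapping.lookup (act f d) j = 0"
  unfolding act_def lookup_sum using assms
  by (intro sum.neutral) (auto simp: lookup_single when_def ran_def)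

lemma keys_act:
  assumes "inj_on f (dom f)" "Poly_Mapping.keys d \<subseteq> dom f"
  shows "Poly_Mapping.keys (act f d) = (\<lambda>i. the (f i)) ` Poly_Mapping.keys d"
proof (intro equalityI subsetI)
  fix j assume j: "j \<in> Poly_Mapping.keys (act f d)"
  then have "j \<in> ran f" using lookup_act_outside[OF assms(2)] by (metis in_keys_iff)
  then obtain i where "f i = Some j" by (auto simp: ran_def)
  then show "j \<in> (\<lambda>i. the (f i)) ` Poly_Mapping.keys d"
    using j lookup_act[OF assms] by (force simp: in_keys_iff image_iff)
next
  fix j assume "j \<in> (\<lambda>i. the (f i)) ` Poly_Mapping.keys d"
  then obtain i where "i \<in> Poly_Mapping.keys d" "f i = Some j" using assms(2) by force
  then show "j \<in> Poly_Mapping.keys (act f d)"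
    using lookup_act[OF assms] by (auto simp: in_keys_iff)
qed

lemma keys_add_nat:
  fixes s t :: "'a monomial"
  shows "Poly_Mapping.keys (s + t) = Poly_Mapping.keys s \<union> Poly_Mapping.keys t"
  by (auto simp: in_keys_iff lookup_add)

lemma keys_eq_empty_nat: "Poly_Mapping.keys (m :: 'a monomial) = {} \<longleftrightarrow> m = 0"
  by (metis in_keys_iff empty_iff keys_zero lookup_zero poly_mapping_eqI)

lemma act_add:
  assumes "inj_on f (dom f)" "Poly_Mapping.keys s \<subseteq> dom f" "Poly_Mapping.keys t \<subseteq> dom f"
  shows "act f (s + t) = act f s + act f t"
proof (rule poly_mapping_eqI)
  fix j
  have st: "Poly_Mapping.keys (s + t) \<subseteq> dom f" using assms by (simp add: keys_add_nat)
  show "Poly_Mapping.lookup (act f (s + t)) j = Poly_Mapping.lookup (act f s + act f t) j"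
  proof (cases "j \<in> ran f")
    case True
    then obtain i where "f i = Some j" by (auto simp: ran_def)
    then show ?thesis
      using lookup_act[OF assms(1)] assms st by (simp add: lookup_add)
  next
    case False
    then show ?thesis using assms st by (simp add: lookup_add lookup_act_outside)
  qed
qed

lemma act_cong:
  "(\<And>i. i \<in> Poly_Mapping.keys d \<Longrightarrow> f i = g i) \<Longrightarrow> act f d = act g d"
  by (simp add: act_def)

lemma act_map_comp:
  assumes "inj_on g (dom g)" "Poly_Mapping.keys d \<subseteq> dom g"
  shows "act f (act g d) = act (f \<circ>\<^sub>m g) d"
proof -
  have dom: "\<exists>j. g i = Some j" if "i \<in> Poly_Mapping.keys d" for i using that assms(2) by auto
  then have inj: "inj_on (\<lambda>i. the (g i)) (Poly_Mapping.keys d)"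
    using assms by (intro inj_onI) (metis domI inj_onD option.sel)
  have "act f (act g d) = (\<Sum>i\<in>Poly_Mapping.keys d.
      Poly_Mapping.single (the (f (the (g i)))) (Poly_Mapping.lookup (act g d) (the (g i))))"
    unfolding act_def[of f] keys_act[OF assms] by (simp add: sum.reindex[OF inj])
  also have "\<dots> = act (f \<circ>\<^sub>m g) d"
    unfolding act_def[of "f \<circ>\<^sub>m g"]
  proof (rule sum.cong[OF refl])
    fix i assume "i \<in> Poly_Mapping.keys d"
    then obtain j where "g i = Some j" using dom by blast
    then show "Poly_Mapping.single (the (f (the (g i)))) (Poly_Mapping.lookup (act g d) (the (g i)))
        = Poly_Mapping.single (the ((f \<circ>\<^sub>m g) i)) (Poly_Mapping.lookup d i)"
      using lookup_act[OF assms] by simp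
  qed
  finally show ?thesis .
qed

lemma act_id:
  assumes "Poly_Mapping.keys d \<subseteq> Y"
  shows "act (Some |` Y) d = d"
proof (rule poly_mapping_eqI)
  fix j
  have *: "inj_on (Some |` Y) (dom (Some |` Y))" "Poly_Mapping.keys d \<subseteq> dom (Some |` Y)"
    using assms by (auto simp: inj_on_def restrict_map_def dom_def split: if_splits)
  show "Poly_Mapping.lookup (act (Some |` Y) d) j = Poly_Mapping.lookup d j"
  proof (cases "j \<in> Y")
    case True
    then show ?thesis using lookup_act[OF *] by simp
  next
    case False
    then have "j \<notin> ran (Some |` Y)" by (auto simp: ran_def restrict_map_def split: if_splits)
    then show ?thesis using lookup_act_outside[OF *(2)] False assms by (auto simp: in_keys_iff)
  qed
qed

lemma zero_monomials [simp]: "0 \<in> monomials X"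
  by (simp add: monomials_def)

lemma add_monomials [simp]: "s + t \<in> monomials X \<longleftrightarrow> s \<in> monomials X \<and> t \<in> monomials X"
  by (auto simp: monomials_def keys_add_nat)

lemma monomials_lookup_eq_0: "m \<in> monomials X \<Longrightarrow> i \<notin> X \<Longrightarrow> Poly_Mapping.lookup m i = 0"
  by (auto simp: monomials_def in_keys_iff)

lemma monomials_eqI:
  assumes "s \<in> monomials X" "t \<in> monomials X"
    and "\<And>i. i \<in> X \<Longrightarrow> Poly_Mapping.lookup s i = Poly_Mapping.lookup t i"
  shows "s = t"
  using assms by (intro poly_mapping_eqI) (metis monomials_lookup_eq_0)

lemma local_inverse_Some:
  assumes "inj_on f (dom f)" "f i = Some j"
  shows "local_inverse f j = Some i"
proof -
  have "(THE x. f x = Some j) = i"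
    using assms by (metis (mono_tags, lifting) domI inj_onD the_equality)
  then show ?thesis using assms(2) by (auto simp: local_inverse_def ran_def)
qed

section \<open>Orbits under a permutation groupoid\<close>

locale perm_groupoid =
  fixes X :: "'a set" and G :: "('a \<rightharpoonup> 'a) set"
  assumes finite_X: "finite X" and groupoid: "permutation_groupoid X G"
begin

lemma
  assumes "f \<in> G"
  shows dom_subset: "dom f \<subseteq> X" and ran_subset: "ran f \<subseteq> X" and inj_on_dom: "inj_on f (dom f)"
  using groupoid assms by (auto simp: permutation_groupoid_def local_bijection_def)

lemma id_mem: "Some |` X \<in> G"
  and restrict_mem: "f \<in> G \<Longrightarrow> Y \<subseteq> dom f \<Longrightarrow> f |` Y \<in> G"
  and local_inverse_mem: "f \<in> G \<Longrightarrow> local_inverse f \<in> G"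
  and map_comp_mem: "f \<in> G \<Longrightarrow> g \<in> G \<Longrightarrow> ran g = dom f \<Longrightarrow> f \<circ>\<^sub>m g \<in> G"
  using groupoid by (auto simp: permutation_groupoid_def)

lemma finite_G: "finite G"
proof -
  have "G \<subseteq> (\<Union>Y\<in>Pow X. {m. dom m = Y \<and> ran m \<subseteq> X})"
    using dom_subset ran_subset by auto
  moreover have "finite (\<Union>Y\<in>Pow X. {m :: 'a \<rightharpoonup> 'a. dom m = Y \<and> ran m \<subseteq> X})"
    using finite_X by (auto intro!: finite_set_of_finite_maps dest: finite_subset)
  ultimately show ?thesis by (rule finite_subset)
qed

lemma finite_orbit: "finite (orbit G d)"
proof -
  have "orbit G d \<subseteq> (\<lambda>f. act f d) ` G" by (auto simp: orbit_def)
  then show ?thesis using finite_G finite_surj by blast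
qed

lemma orbit_monomials: "m \<in> orbit G d \<Longrightarrow> m \<in> monomials X"
  using ran_subset by (force simp: orbit_def monomials_def keys_act[OF inj_on_dom] ran_def)

lemma orbit_refl: "d \<in> monomials X \<Longrightarrow> d \<in> orbit G d"
  using id_mem act_id[of d X] by (force simp: orbit_def monomials_def restrict_map_def dom_def)

text \<open>Composition in the groupoid requires the range of the inner map to equal the domain of
  the outer one. Restricting to the support of \<open>d\<close> makes the range the support of
  \<open>m\<close>, so that maps between monomials of one orbit become composable.\<close>

lemma orbitE:
  assumes "m \<in> orbit G d"
  obtains f where "f \<in> G" "dom f = Poly_Mapping.keys d" "ran f = Poly_Mapping.keys m" "m = act f d"
proof -
  obtain g where g: "g \<in> G" "m = act g d" "Poly_Mapping.keys d \<subseteq> dom g"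
    using assms by (auto simp: orbit_def)
  let ?f = "g |` Poly_Mapping.keys d"
  have f: "?f \<in> G" "dom ?f = Poly_Mapping.keys d" using g restrict_mem by auto
  have m: "m = act ?f d" unfolding g(2) by (rule act_cong) simp
  have "Poly_Mapping.keys m = ran ?f"
    unfolding m using keys_act[OF inj_on_dom[OF f(1)]] f(2)
    by (force simp: ran_def restrict_map_def image_iff split: if_splits)
  then show thesis using that f m by auto
qed

lemma orbit_trans:
  assumes "m \<in> orbit G d" "m' \<in> orbit G m"
  shows "m' \<in> orbit G d"
proof -
  obtain g where g: "g \<in> G" "dom g = Poly_Mapping.keys d" "ran g = Poly_Mapping.keys m" "m = act g d"
    using orbitE[OF assms(1)] .
  obtain f where f: "f \<in> G" "dom f = Poly_Mapping.keys m" "m' = act f m"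
    using orbitE[OF assms(2)] by metis
  have "f \<circ>\<^sub>m g \<in> G" using f g map_comp_mem by simp
  moreover have "m' = act (f \<circ>\<^sub>m g) d" using f(3) g act_map_comp[OF inj_on_dom[OF g(1)], of d f] by simp
  moreover have "Poly_Mapping.keys d \<subseteq> dom (f \<circ>\<^sub>m g)"
  proof
    fix i assume "i \<in> Poly_Mapping.keys d"
    then obtain j where j: "g i = Some j" using g by auto
    then have "j \<in> dom f" using f g by (auto intro: ranI)
    then show "i \<in> dom (f \<circ>\<^sub>m g)" using j by auto
  qed
  ultimately show ?thesis by (auto simp: orbit_def)
qed

lemma orbit_sym:
  assumes "m \<in> orbit G d"
  shows "d \<in> orbit G m"
proof -
  obtain g where g: "g \<in> G" "dom g = Poly_Mapping.keys d" "ran g = Poly_Mapping.keys m" "m = act g d"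
    using orbitE[OF assms] .
  have "act (local_inverse g) m = act (local_inverse g \<circ>\<^sub>m g) d"
    using g act_map_comp[OF inj_on_dom[OF g(1)], of d "local_inverse g"] by simp
  also have "\<dots> = act (Some |` Poly_Mapping.keys d) d"
  proof (rule act_cong)
    fix i assume i: "i \<in> Poly_Mapping.keys d"
    then obtain j where "g i = Some j" using g by auto
    then show "(local_inverse g \<circ>\<^sub>m g) i = (Some |` Poly_Mapping.keys d) i"
      using local_inverse_Some[OF inj_on_dom[OF g(1)]] i by simp
  qed
  finally have "act (local_inverse g) m = d" by (simp add: act_id)
  moreover have "Poly_Mapping.keys m \<subseteq> dom (local_inverse g)"
    using g by (auto simp: local_inverse_def)
  ultimately show ?thesis using local_inverse_mem[OF g(1)] by (force simp: orbit_def)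
qed

end

section \<open>Initial monomials of invariants\<close>

lemma module_scale: "module (scale :: 'k::field \<Rightarrow> ('a, 'k) mpoly \<Rightarrow> ('a, 'k) mpoly)"
proof -
  interpret vector_space "scale :: 'k \<Rightarrow> ('a, 'k) mpoly \<Rightarrow> ('a, 'k) mpoly"
    by (rule vector_space_scale)
  show ?thesis by unfold_locales
qed

lemma lookup_scale:
  "Poly_Mapping.lookup (scale c p) m = c * Poly_Mapping.lookup p m"
  by (simp add: scale_def map.rep_eq when_def flip: mult_map_scale_conv_mult)

text \<open>These turn out to be the initial monomials of the invariant ring, see
  \<open>initials_invariant_ring\<close>.\<close>

definition maximal_monomials :: "'a set \<Rightarrow> ('a \<rightharpoonup> 'a) set \<Rightarrow> 'a monomial rel \<Rightarrow> 'a monomial set" where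
  "maximal_monomials X G r = {m \<in> monomials X. \<forall>m'\<in>orbit G m. (m', m) \<in> r}"

locale ordered_perm_groupoid = perm_groupoid +
  fixes r :: "'a monomial rel"
  assumes admissible: "admissible_order X r"
begin

abbreviation "M \<equiv> maximal_monomials X G r"

lemma linear_order: "linear_order_on (monomials X) r"
  and order_add: "(s, t) \<in> r \<Longrightarrow> u \<in> monomials X \<Longrightarrow> (s + u, t + u) \<in> r"
  using admissible by (auto simp: admissible_order_def)

lemma order_refl: "s \<in> monomials X \<Longrightarrow> (s, s) \<in> r"
  using linear_order by (simp add: order_on_defs refl_on_def)

lemma order_antisym: "(s, t) \<in> r \<Longrightarrow> (t, s) \<in> r \<Longrightarrow> s = t"
  using linear_order by (auto simp: order_on_defs dest: antisymD)

lemma order_trans: "(s, t) \<in> r \<Longrightarrow> (t, u) \<in> r \<Longrightarrow> (s, u) \<in> r"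
  using linear_order by (auto simp: order_on_defs dest: transD)

lemma order_total: "s \<in> monomials X \<Longrightarrow> t \<in> monomials X \<Longrightarrow> (s, t) \<in> r \<or> (t, s) \<in> r"
  using linear_order order_refl by (cases "s = t") (auto simp: order_on_defs total_on_def)

lemma order_dom: "(s, t) \<in> r \<Longrightarrow> s \<in> monomials X \<and> t \<in> monomials X"
  using linear_order by (auto simp: order_on_defs)

lemma order_add_mono: "(s, t) \<in> r \<Longrightarrow> (s', t') \<in> r \<Longrightarrow> (s + s', t + t') \<in> r"
  using order_add[of s t s'] order_add[of s' t' t] order_dom order_trans
  by (metis add.commute)

lemma finite_has_max:
  "finite S \<Longrightarrow> S \<noteq> {} \<Longrightarrow> S \<subseteq> monomials X \<Longrightarrow> \<exists>m\<in>S. \<forall>s\<in>S. (s, m) \<in> r"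
  by (rule linear_order_on_finite_has_max[OF linear_order])

lemma maximal_in_orbit:
  assumes "d \<in> monomials X"
  obtains m where "m \<in> orbit G d" "m \<in> M"
proof -
  have "\<exists>m\<in>orbit G d. \<forall>s\<in>orbit G d. (s, m) \<in> r"
    using orbit_refl[OF assms] orbit_monomials by (intro finite_has_max finite_orbit) auto
  then show thesis
    using that orbit_trans orbit_monomials by (auto simp: maximal_monomials_def)
qed

lemma maximal_unique:
  assumes "m \<in> M" "m' \<in> M" "m' \<in> orbit G m"
  shows "m' = m"
  using assms orbit_sym[OF assms(3)] order_antisym by (auto simp: maximal_monomials_def)

lemma maximal_zero: "0 \<in> M"
  using order_refl[of 0] by (auto simp: maximal_monomials_def orbit_def act_def)

text \<open>A map defined on the support of a product acts on both factors separately, and it makes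
  neither of them larger.\<close>

lemma maximal_add:
  assumes "s \<in> M" "t \<in> M"
  shows "s + t \<in> M"
proof -
  have "(act f (s + t), s + t) \<in> r" if "f \<in> G" "Poly_Mapping.keys (s + t) \<subseteq> dom f" for f
    using that assms act_add[OF inj_on_dom[OF that(1)], of s t]
    by (auto simp: keys_add_nat maximal_monomials_def orbit_def intro!: order_add_mono)
  then show ?thesis using assms by (auto simp: maximal_monomials_def orbit_def)
qed

lemma monoid_generated_maximal: "S \<subseteq> M \<Longrightarrow> x \<in> monoid_generated S \<Longrightarrow> x \<in> M"
  by (rotate_tac, induction rule: monoid_generated.induct)
    (auto intro: maximal_zero maximal_add)

lemma initial_eqI:
  "m \<in> Poly_Mapping.keys p \<Longrightarrow> (\<And>s. s \<in> Poly_Mapping.keys p \<Longrightarrow> (s, m) \<in> r) \<Longrightarrow> initial r p = m"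
  unfolding initial_def by (rule the_equality) (auto intro: order_antisym)

lemma initial_max:
  assumes "p \<noteq> 0" "Poly_Mapping.keys p \<subseteq> monomials X"
  shows "initial r p \<in> Poly_Mapping.keys p"
    and "s \<in> Poly_Mapping.keys p \<Longrightarrow> (s, initial r p) \<in> r"
proof -
  obtain m where m: "m \<in> Poly_Mapping.keys p" "\<forall>s\<in>Poly_Mapping.keys p. (s, m) \<in> r"
    using finite_has_max[of "Poly_Mapping.keys p"] assms by auto
  then have "initial r p = m" by (auto intro: initial_eqI)
  then show "initial r p \<in> Poly_Mapping.keys p"
    and "s \<in> Poly_Mapping.keys p \<Longrightarrow> (s, initial r p) \<in> r"
    using m by auto
qed

lemma lookup_orbit_sum:
  "Poly_Mapping.lookup (orbit_sum G d :: ('a, 'k::field) mpoly) m = (if m \<in> orbit G d then 1 else 0)"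
  using finite_orbit[of d] by (simp add: orbit_sum_def lookup_sum lookup_single when_def)

lemma keys_orbit_sum: "Poly_Mapping.keys (orbit_sum G d :: ('a, 'k::field) mpoly) = orbit G d"
  by (auto simp: in_keys_iff lookup_orbit_sum split: if_splits)

lemma orbit_sum_invariant:
  "d \<in> monomials X \<Longrightarrow> (orbit_sum G d :: ('a, 'k::field) mpoly) \<in> invariant_ring X G"
  unfolding invariant_ring_def by (intro module.span_base[OF module_scale]) auto

text \<open>Both properties hold for orbit sums, because orbits are equivalence classes, and they
  pass to linear combinations.\<close>

lemma invariant_ring_lookup:
  fixes p :: "('a, 'k::field) mpoly"
  assumes "p \<in> invariant_ring X G"
  shows "Poly_Mapping.keys p \<subseteq> monomials X \<and>
    (\<forall>m. \<forall>m'\<in>orbit G m. Poly_Mapping.lookup p m' = Poly_Mapping.lookup p m)"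
  using assms unfolding invariant_ring_def
proof (induction rule: module.span_induct_alt[OF module_scale, consumes 1, case_names base step])
  case base
  show ?case by simp
next
  case (step c x y)
  then obtain d where d: "x = orbit_sum G d" by auto
  have "Poly_Mapping.lookup x m' = Poly_Mapping.lookup x m" if "m' \<in> orbit G m" for m m'
    using orbit_trans[of m d m'] orbit_trans[of m' d m] that orbit_sym[OF that]
    unfolding d lookup_orbit_sum by auto
  moreover have "Poly_Mapping.keys (scale c x + y) \<subseteq> monomials X"
  proof
    fix m assume "m \<in> Poly_Mapping.keys (scale c x + y)"
    then have "m \<in> Poly_Mapping.keys x \<or> m \<in> Poly_Mapping.keys y"
      by (auto simp: in_keys_iff lookup_add lookup_scale)
    then show "m \<in> monomials X" using step d orbit_monomials by (auto simp: keys_orbit_sum)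
  qed
  ultimately show ?case using step by (auto simp: lookup_add lookup_scale)
qed

lemma initial_orbit_sum:
  "m \<in> M \<Longrightarrow> initial r (orbit_sum G m :: ('a, 'k::field) mpoly) = m"
  by (rule initial_eqI) (auto simp: keys_orbit_sum maximal_monomials_def orbit_refl)

lemma orbit_sum_nonzero:
  assumes "m \<in> monomials X"
  shows "(orbit_sum G m :: ('a, 'k::field) mpoly) \<noteq> 0"
  using keys_orbit_sum[of m, where 'k = 'k] orbit_refl[OF assms] by auto

text \<open>An invariant that contains a monomial contains its whole orbit, so its initial monomial
  is maximal in its orbit. Conversely, a maximal monomial is the initial monomial of its own orbit
  sum.\<close>

lemma initials_invariant_ring: "initials r (invariant_ring X G :: ('a, 'k::field) mpoly set) = M"
proof (intro equalityI subsetI)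
  fix m assume "m \<in> initials r (invariant_ring X G :: ('a, 'k) mpoly set)"
  then obtain p :: "('a, 'k) mpoly" where
    p: "p \<in> invariant_ring X G" "p \<noteq> 0" "m = initial r p"
    by (auto simp: initials_def)
  note inv = invariant_ring_lookup[OF p(1)]
  have m: "m \<in> Poly_Mapping.keys p" using initial_max p inv by auto
  have "(m', m) \<in> r" if "m' \<in> orbit G m" for m'
  proof -
    have "Poly_Mapping.lookup p m' = Poly_Mapping.lookup p m" using inv that by blast
    then have "m' \<in> Poly_Mapping.keys p" using m by (simp add: in_keys_iff)
    then show ?thesis using initial_max p inv by auto
  qed
  then show "m \<in> M" using m inv by (auto simp: maximal_monomials_def)
next
  fix m assume m: "m \<in> M"
  then have X: "m \<in> monomials X" by (simp add: maximal_monomials_def)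
  then show "m \<in> initials r (invariant_ring X G :: ('a, 'k) mpoly set)"
    using initial_orbit_sum[OF m, where 'k = 'k] orbit_sum_nonzero[OF X, where 'k = 'k]
      orbit_sum_invariant[OF X, where 'k = 'k]
    by (force simp: initials_def)
qed

text \<open>Only initial monomials matter: those of a finite basis generate \<open>M\<close>, and
  finitely many generators of \<open>M\<close> are the initial monomials of their orbit
  sums.\<close>

lemma finite_sagbi_basis_iff:
  "(\<exists>B :: ('a, 'k::field) mpoly set. finite B \<and> sagbi_basis r (invariant_ring X G) B) \<longleftrightarrow>
    (\<exists>S. finite S \<and> monoid_generated S = M)"
proof
  assume "\<exists>B :: ('a, 'k) mpoly set. finite B \<and> sagbi_basis r (invariant_ring X G) B"
  then obtain B :: "('a, 'k) mpoly set" where B: "finite B" "sagbi_basis r (invariant_ring X G) B"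
    by blast
  have "initials r B \<subseteq> initial r ` B" by (auto simp: initials_def)
  then have "finite (initials r B)" using B(1) finite_surj by blast
  moreover have "monoid_generated (initials r B) = M"
    using B(2) initials_invariant_ring[where 'k = 'k] by (simp add: sagbi_basis_def)
  ultimately show "\<exists>S. finite S \<and> monoid_generated S = M" by blast
next
  assume "\<exists>S. finite S \<and> monoid_generated S = M"
  then obtain S where S: "finite S" "monoid_generated S = M" by blast
  have SM: "S \<subseteq> M" using S(2) by (auto intro: monoid_generated.base)
  then have X: "S \<subseteq> monomials X" by (auto simp: maximal_monomials_def)
  define B :: "('a, 'k) mpoly set" where "B = orbit_sum G ` S"
  have "initials r B = S"
  proof -
    have "initials r B = initial r ` B"
      unfolding initials_def B_def using orbit_sum_nonzero[where 'k = 'k] X by blast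
    also have "\<dots> = S"
      unfolding B_def using SM initial_orbit_sum[where 'k = 'k] by (force simp: image_iff)
    finally show ?thesis .
  qed
  moreover have "B \<subseteq> invariant_ring X G"
    unfolding B_def using orbit_sum_invariant X by blast
  moreover have "finite B" unfolding B_def using S(1) by simp
  ultimately show "\<exists>B :: ('a, 'k) mpoly set. finite B \<and> sagbi_basis r (invariant_ring X G) B"
    using S(2) initials_invariant_ring[where 'k = 'k] by (auto simp: sagbi_basis_def)
qed

end

section \<open>Permutations of all variables\<close>

definition perm_act :: "'a set \<Rightarrow> ('a \<Rightarrow> 'a) \<Rightarrow> 'a monomial \<Rightarrow> 'a monomial" where
  "perm_act X h m = act ((Some \<circ> h) |` X) m"

lemma Bij_mem: "h \<in> Bij X \<Longrightarrow> i \<in> X \<Longrightarrow> h i \<in> X"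
  by (auto simp: Bij_def bij_betw_def)

lemma Bij_eq_iff: "h \<in> Bij X \<Longrightarrow> i \<in> X \<Longrightarrow> j \<in> X \<Longrightarrow> h i = h j \<longleftrightarrow> i = j"
  by (auto simp: Bij_def bij_betw_def inj_on_eq_iff)

lemma Bij_surj: "h \<in> Bij X \<Longrightarrow> j \<in> X \<Longrightarrow> \<exists>i\<in>X. h i = j"
  by (force simp: Bij_def bij_betw_def)

lemma Bij_eqI: "g \<in> Bij X \<Longrightarrow> h \<in> Bij X \<Longrightarrow> (\<And>i. i \<in> X \<Longrightarrow> g i = h i) \<Longrightarrow> g = h"
  by (auto simp: Bij_def intro: extensionalityI)

lemma dom_Some_comp [simp]: "dom (Some \<circ> h) = UNIV"
  by auto

lemma
  shows dom_Some_restrict: "dom ((Some \<circ> h) |` X) = X"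
    and ran_Some_restrict: "ran ((Some \<circ> h) |` X) = h ` X"
  by (auto simp: ran_def restrict_map_def dom_def split: if_splits)

lemma inj_Some_restrict: "h \<in> Bij X \<Longrightarrow> inj_on ((Some \<circ> h) |` X) (dom ((Some \<circ> h) |` X))"
  by (auto simp: dom_Some_restrict Bij_def bij_betw_def inj_on_def restrict_map_def)

lemma lookup_perm_act:
  assumes "h \<in> Bij X" "m \<in> monomials X" "i \<in> X"
  shows "Poly_Mapping.lookup (perm_act X h m) (h i) = Poly_Mapping.lookup m i"
  unfolding perm_act_def using assms
  by (intro lookup_act inj_Some_restrict) (auto simp: dom_Some_restrict monomials_def)

lemma perm_act_monomials:
  assumes "h \<in> Bij X" "m \<in> monomials X"
  shows "perm_act X h m \<in> monomials X"
proof -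
  have "Poly_Mapping.keys (perm_act X h m) = (\<lambda>i. the (((Some \<circ> h) |` X) i)) ` Poly_Mapping.keys m"
    unfolding perm_act_def using assms(2)
    by (intro keys_act inj_Some_restrict assms(1)) (simp add: monomials_def)
  also have "\<dots> \<subseteq> X"
    using assms Bij_mem[OF assms(1)] by (auto simp: monomials_def subset_iff)
  finally show ?thesis by (simp add: monomials_def)
qed

lemma perm_act_eqI:
  assumes "h \<in> Bij X" "m \<in> monomials X" "s \<in> monomials X"
    and "\<And>i. i \<in> X \<Longrightarrow> Poly_Mapping.lookup s (h i) = Poly_Mapping.lookup m i"
  shows "perm_act X h m = s"
proof (rule monomials_eqI[OF perm_act_monomials[OF assms(1,2)] assms(3)])
  fix j assume "j \<in> X"
  then obtain i where "i \<in> X" "h i = j" using Bij_surj[OF assms(1)] by blast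
  then show "Poly_Mapping.lookup (perm_act X h m) j = Poly_Mapping.lookup s j"
    using lookup_perm_act[OF assms(1,2)] assms(4) by metis
qed

lemma perm_act_compose:
  assumes "g \<in> Bij X" "h \<in> Bij X" "m \<in> monomials X"
  shows "perm_act X (compose X g h) m = perm_act X g (perm_act X h m)"
  using assms
  by (intro perm_act_eqI compose_Bij perm_act_monomials)
    (auto simp: compose_def lookup_perm_act perm_act_monomials Bij_mem)

lemma perm_act_add:
  assumes "h \<in> Bij X" "s \<in> monomials X" "t \<in> monomials X"
  shows "perm_act X h (s + t) = perm_act X h s + perm_act X h t"
  using assms by (intro perm_act_eqI) (auto simp: perm_act_monomials lookup_add lookup_perm_act)

section \<open>The group of permutations of \<open>X\<close>\<close>

lemma mult_BijGroup: "g \<in> Bij X \<Longrightarrow> h \<in> Bij X \<Longrightarrow> g \<otimes>\<^bsub>BijGroup X\<^esub> h = compose X g h"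
  by (simp add: BijGroup_def)

lemma carrier_BijGroup: "carrier (BijGroup X) = Bij X"
  by (simp add: BijGroup_def)

lemma one_BijGroup: "\<one>\<^bsub>BijGroup X\<^esub> = (\<lambda>x\<in>X. x)"
  by (simp add: BijGroup_def)

lemma inv_BijGroup:
  assumes "h \<in> Bij X"
  shows "inv\<^bsub>BijGroup X\<^esub> h \<in> Bij X" "i \<in> X \<Longrightarrow> (inv\<^bsub>BijGroup X\<^esub> h) (h i) = i"
    "i \<in> X \<Longrightarrow> h ((inv\<^bsub>BijGroup X\<^esub> h) i) = i"
proof -
  interpret group "BijGroup X" by (rule group_BijGroup)
  let ?k = "inv\<^bsub>BijGroup X\<^esub> h"
  show k: "?k \<in> Bij X" using inv_closed[of h] assms by (simp add: carrier_BijGroup)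
  have "compose X ?k h = (\<lambda>x\<in>X. x)" "compose X h ?k = (\<lambda>x\<in>X. x)"
    using l_inv[of h] r_inv[of h] assms k
    by (simp_all add: carrier_BijGroup mult_BijGroup one_BijGroup)
  then show "i \<in> X \<Longrightarrow> ?k (h i) = i" "i \<in> X \<Longrightarrow> h (?k i) = i"
    by (metis compose_eq restrict_apply')+
qed

lemma perm_act_inv:
  assumes "h \<in> Bij X" "m \<in> monomials X"
  shows "perm_act X (inv\<^bsub>BijGroup X\<^esub> h) (perm_act X h m) = m"
    and "perm_act X h (perm_act X (inv\<^bsub>BijGroup X\<^esub> h) m) = m"
proof -
  note i = inv_BijGroup[OF assms(1)]
  have mm: "perm_act X h m \<in> monomials X" "perm_act X (inv\<^bsub>BijGroup X\<^esub> h) m \<in> monomials X"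
    using assms i(1) by (auto intro: perm_act_monomials)
  show "perm_act X (inv\<^bsub>BijGroup X\<^esub> h) (perm_act X h m) = m"
  proof (rule perm_act_eqI[OF i(1) mm(1) assms(2)])
    fix j assume "j \<in> X"
    then show "Poly_Mapping.lookup m ((inv\<^bsub>BijGroup X\<^esub> h) j) = Poly_Mapping.lookup (perm_act X h m) j"
      using lookup_perm_act[OF assms, of "(inv\<^bsub>BijGroup X\<^esub> h) j"] i Bij_mem[OF i(1)] by simp
  qed
  show "perm_act X h (perm_act X (inv\<^bsub>BijGroup X\<^esub> h) m) = m"
  proof (rule perm_act_eqI[OF assms(1) mm(2) assms(2)])
    fix j assume "j \<in> X"
    then show "Poly_Mapping.lookup m (h j) = Poly_Mapping.lookup (perm_act X (inv\<^bsub>BijGroup X\<^esub> h) m) j"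
      using lookup_perm_act[OF i(1) assms(2), of "h j"] i Bij_mem[OF assms(1)] by simp
  qed
qed

abbreviation transposition_on :: "'a set \<Rightarrow> 'a \<Rightarrow> 'a \<Rightarrow> 'a \<Rightarrow> 'a" where
  "transposition_on X i j \<equiv> restrict (Transposition.transpose i j) X"

lemma transp_Bij:
  assumes "i \<in> X" "j \<in> X"
  shows "transposition_on X i j \<in> Bij X"
proof -
  have "bij_betw (Transposition.transpose i j) X X" using assms by simp
  then show ?thesis by (simp add: Bij_def cong: bij_betw_cong)
qed

text \<open>When \<open>H\<close> is generated by transpositions, this is the relation of lying in
  the same \<open>H\<close>-orbit of variables, by \<open>linked_generate\<close>.\<close>

definition linked :: "'a set \<Rightarrow> ('a \<Rightarrow> 'a) set \<Rightarrow> 'a \<Rightarrow> 'a \<Rightarrow> bool" where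
  "linked X H i j \<longleftrightarrow> i \<in> X \<and> j \<in> X \<and> (i = j \<or> transposition_on X i j \<in> H)"

lemma linked_sym: "linked X H i j \<Longrightarrow> linked X H j i"
  by (auto simp: linked_def transpose_commute)

text \<open>Conjugating one transposition by the other gives (j k)(i j)(j k) = (i k).\<close>

lemma linked_trans:
  assumes H: "subgroup H (BijGroup X)" and "linked X H i j" "linked X H j k"
  shows "linked X H i k"
proof (cases "i = j \<or> j = k \<or> i = k")
  case True
  then show ?thesis using assms by (auto simp: linked_def)
next
  case False
  then have X: "i \<in> X" "j \<in> X" "k \<in> X" and t: "transposition_on X i j \<in> H" "transposition_on X j k \<in> H"
    using assms by (auto simp: linked_def)
  have B: "transposition_on X i j \<in> Bij X" "transposition_on X j k \<in> Bij X" using X by (auto intro: transp_Bij)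
  have "transposition_on X j k \<otimes>\<^bsub>BijGroup X\<^esub> (transposition_on X i j \<otimes>\<^bsub>BijGroup X\<^esub> transposition_on X j k) \<in> H"
    using t subgroup.m_closed[OF H] by blast
  also have "transposition_on X j k \<otimes>\<^bsub>BijGroup X\<^esub> (transposition_on X i j \<otimes>\<^bsub>BijGroup X\<^esub> transposition_on X j k)
      = compose X (transposition_on X j k) (compose X (transposition_on X i j) (transposition_on X j k))"
    using B by (simp add: mult_BijGroup compose_Bij)
  also have "\<dots> = transposition_on X i k"
    using False X by (auto simp: fun_eq_iff compose_def restrict_def Transposition.transpose_def)
  finally show ?thesis using X unfolding linked_def by blast
qed

text \<open>Each generator moves a variable to a linked one. Symmetry then takes care of inverses
  and transitivity of products.\<close>

lemma linked_generate:
  assumes T: "T \<subseteq> transpositions X" and h: "h \<in> generate (BijGroup X) T" and i: "i \<in> X"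
  shows "linked X (generate (BijGroup X) T) i (h i)"
proof -
  let ?H = "generate (BijGroup X) T"
  interpret group "BijGroup X" by (rule group_BijGroup)
  have TX: "T \<subseteq> carrier (BijGroup X)"
    using T by (auto simp: transpositions_def carrier_BijGroup intro: transp_Bij)
  have H: "subgroup ?H (BijGroup X)" using TX by (rule generate_is_subgroup)
  then have HB: "?H \<subseteq> Bij X" using subgroup.subset carrier_BijGroup by blast
  have base: "\<forall>i\<in>X. linked X ?H i (h i)" if h: "h \<in> T" for h
  proof -
    obtain a b where ab: "h = transposition_on X a b" "a \<in> X" "b \<in> X"
      using h T by (auto simp: transpositions_def)
    have "h \<in> ?H" using h by (rule generate.incl)
    then have "transposition_on X a b \<in> ?H" "transposition_on X b a \<in> ?H" unfolding ab by (simp_all add: transpose_commute)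
    then have "linked X ?H a b" "linked X ?H b a" using ab by (simp_all add: linked_def)
    then show ?thesis using ab
      by (simp add: Transposition.transpose_def) (simp add: linked_def)
  qed
  have "\<forall>i\<in>X. linked X ?H i (h i)" using h
  proof induction
    case one
    then show ?case by (auto simp: one_BijGroup linked_def)
  next
    case (incl h)
    then show ?case by (rule base)
  next
    case (inv h)
    then have hB: "h \<in> Bij X" using TX by (auto simp: carrier_BijGroup)
    show ?case
    proof
      fix i assume "i \<in> X"
      let ?j = "(inv\<^bsub>BijGroup X\<^esub> h) i"
      have "?j \<in> X" using Bij_mem[OF inv_BijGroup(1)[OF hB] \<open>i \<in> X\<close>] .
      then have "linked X ?H ?j (h ?j)" using base[OF inv] by blast
      then show "linked X ?H i ?j" using inv_BijGroup(3)[OF hB \<open>i \<in> X\<close>] linked_sym by metis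
    qed
  next
    case (eng g h)
    then have gh: "g \<in> Bij X" "h \<in> Bij X" using HB by auto
    show ?case
    proof
      fix i assume "i \<in> X"
      then have "linked X ?H i (h i)" "linked X ?H (h i) (g (h i))"
        using eng.IH Bij_mem[OF gh(2)] by auto
      then have "linked X ?H i (g (h i))" by (rule linked_trans[OF H])
      then show "linked X ?H i ((g \<otimes>\<^bsub>BijGroup X\<^esub> h) i)"
        using gh \<open>i \<in> X\<close> by (simp add: mult_BijGroup compose_eq)
    qed
  qed
  then show ?thesis using i by blast
qed

definition monomial_of :: "'a set \<Rightarrow> ('a \<Rightarrow> nat) \<Rightarrow> 'a monomial" where
  "monomial_of Y f = (\<Sum>i\<in>Y. Poly_Mapping.single i (f i))"

lemma lookup_monomial_of:
  "finite Y \<Longrightarrow> Poly_Mapping.lookup (monomial_of Y f) i = (if i \<in> Y then f i else 0)"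
  by (simp add: monomial_of_def lookup_sum lookup_single when_def)

lemma monomial_of_monomials: "finite Y \<Longrightarrow> Y \<subseteq> X \<Longrightarrow> monomial_of Y f \<in> monomials X"
  by (auto simp: monomials_def in_keys_iff lookup_monomial_of split: if_splits)

section \<open>Groups generated by transpositions\<close>

context ordered_perm_groupoid
begin

abbreviation var_le :: "'a \<Rightarrow> 'a \<Rightarrow> bool" where
  "var_le i j \<equiv> (Poly_Mapping.single i (1::nat), Poly_Mapping.single j 1) \<in> r"

lemma single_monomials: "i \<in> X \<Longrightarrow> Poly_Mapping.single i n \<in> monomials X"
  by (auto simp: monomials_def)

lemma single_le:
  assumes "var_le i j"
  shows "(Poly_Mapping.single i n, Poly_Mapping.single j n) \<in> r"
proof (induction n)
  case 0
  then show ?case by (simp add: order_refl)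
next
  case (Suc n)
  then show ?case using order_add_mono[OF Suc assms] by (simp flip: single_add)
qed

text \<open>Splitting off the excess exponent \<open>d\<close> of variable \<open>i\<close> leaves a
  monomial \<open>c\<close> with equal exponents at \<open>i\<close> and \<open>k\<close>. The
  transposition fixes \<open>c\<close> and moves the \<open>d\<close>-th power from \<open>i\<close>
  to \<open>k\<close>, which is not larger.\<close>

lemma transp_act_le:
  assumes m: "m \<in> monomials X" and X: "i \<in> X" "k \<in> X" and le: "var_le k i"
    and mki: "Poly_Mapping.lookup m k \<le> Poly_Mapping.lookup m i"
  shows "(perm_act X (transposition_on X i k) m, m) \<in> r"
proof -
  define d where "d = Poly_Mapping.lookup m i - Poly_Mapping.lookup m k"
  define c where "c = m - Poly_Mapping.single i d"
  have cl: "Poly_Mapping.lookup c j = (if j = i then Poly_Mapping.lookup m k else Poly_Mapping.lookup m j)" for j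
    using mki by (auto simp: c_def d_def lookup_minus lookup_single)
  have c: "c \<in> monomials X"
    using m X by (auto simp: monomials_def in_keys_iff cl subset_iff split: if_splits)
  have "m = c + Poly_Mapping.single i d"
    using mki by (intro poly_mapping_eqI) (auto simp: lookup_add cl lookup_single d_def when_def)
  moreover have "perm_act X (transposition_on X i k) m = c + Poly_Mapping.single k d"
  proof (rule perm_act_eqI[OF transp_Bij m])
    fix j assume "j \<in> X"
    then show "Poly_Mapping.lookup (c + Poly_Mapping.single k d) (transposition_on X i k j) = Poly_Mapping.lookup m j"
      using mki by (auto simp: lookup_add cl lookup_single d_def when_def Transposition.transpose_def)
  qed (use X c single_monomials in auto)
  moreover have "(c + Poly_Mapping.single k d, c + Poly_Mapping.single i d) \<in> r"
    using single_le[OF le] c order_refl by (intro order_add_mono)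
  ultimately show ?thesis by simp
qed

definition sorted_monomials :: "('a \<Rightarrow> 'a \<Rightarrow> bool) \<Rightarrow> 'a monomial set" where
  "sorted_monomials R = {m \<in> monomials X.
     \<forall>i j. R i j \<longrightarrow> var_le j i \<longrightarrow> Poly_Mapping.lookup m j \<le> Poly_Mapping.lookup m i}"

text \<open>This is selection sort, by induction on the number of moved variables: composing with a
  transposition puts the largest moved variable \<open>i\<close> back in place and leaves a
  permutation \<open>h'\<close> that moves fewer variables.\<close>

lemma sorted_perm_act_le:
  assumes R: "\<And>i j. R i j \<Longrightarrow> R j i" "\<And>i j k. R i j \<Longrightarrow> R j k \<Longrightarrow> R i k"
    and m: "m \<in> sorted_monomials R"
    and h: "h \<in> Bij X" "\<And>i. i \<in> X \<Longrightarrow> R i (h i)"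
  shows "(perm_act X h m, m) \<in> r"
  using h
proof (induction "card {i \<in> X. h i \<noteq> i}" arbitrary: h rule: less_induct)
  case less
  note hB = less.prems(1) and hR = less.prems(2)
  have mX: "m \<in> monomials X" using m by (simp add: sorted_monomials_def)
  show ?case
  proof (cases "{i \<in> X. h i \<noteq> i} = {}")
    case True
    then have "perm_act X h m = m" using hB mX by (intro perm_act_eqI) auto
    then show ?thesis using order_refl mX by simp
  next
    case False
    define e :: "'a \<Rightarrow> 'a monomial" where "e i = Poly_Mapping.single i 1" for i
    have "\<exists>s\<in>e ` {i \<in> X. h i \<noteq> i}. \<forall>s'\<in>e ` {i \<in> X. h i \<noteq> i}. (s', s) \<in> r"
      using False finite_X by (intro finite_has_max) (auto simp: e_def single_monomials)
    then obtain i where i: "i \<in> X" "h i \<noteq> i"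
      and max: "\<And>j. j \<in> X \<Longrightarrow> h j \<noteq> j \<Longrightarrow> var_le j i"
      by (auto simp: e_def)
    obtain j where j: "j \<in> X" "h j = i" using Bij_surj[OF hB i(1)] by blast
    define k where "k = h i"
    have k: "k \<in> X" "h k \<noteq> k" "k \<noteq> i"
      using i hB Bij_mem[OF hB] Bij_eq_iff[OF hB] by (auto simp: k_def)
    \<comment> \<open>Since \<open>h'\<close> fixes \<open>i\<close> and sends \<open>j\<close> to
      \<open>k\<close>, it puts the exponent of \<open>m\<close> at \<open>j\<close> to position
      \<open>k\<close> and keeps the one at \<open>i\<close>, which is not smaller because
      \<open>m\<close> is sorted and \<open>j\<close> is moved. So the transposition leading from
      \<open>h'\<close> back to \<open>h\<close> cannot increase the monomial.\<close>
    define h' where "h' = compose X (transposition_on X i k) h"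
    have h'B: "h' \<in> Bij X" unfolding h'_def using hB i k by (intro compose_Bij transp_Bij) auto
    have h': "h' l = Transposition.transpose i k (h l)" if "l \<in> X" for l
      using that Bij_mem[OF hB] by (simp add: h'_def compose_eq)
    have h'i: "h' i = i" "h' j = k" using h' i j by (simp_all add: k_def)
    have fixed: "h' l = l" if "l \<in> X" "h l = l" for l
      using h'[OF that(1)] that i k by (metis transpose_apply_other)
    have "{l \<in> X. h' l \<noteq> l} \<subset> {l \<in> X. h l \<noteq> l}"
      using fixed i h'i by auto
    then have "card {l \<in> X. h' l \<noteq> l} < card {l \<in> X. h l \<noteq> l}"
      using finite_X by (intro psubset_card_mono) auto
    moreover have "R l (h' l)" if l: "l \<in> X" for l
    proof -
      have "R i k" using hR[OF i(1)] by (simp add: k_def)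
      have "R l (h l)" using hR l by blast
      consider "h l = i" | "h l = k" | "h l \<noteq> i" "h l \<noteq> k" by blast
      then show ?thesis
      proof cases
        case 1
        then show ?thesis using R(2)[OF \<open>R l (h l)\<close>] \<open>R i k\<close> h'[OF l] by simp
      next
        case 2
        then show ?thesis using R(2)[OF \<open>R l (h l)\<close>] R(1)[OF \<open>R i k\<close>] h'[OF l] by simp
      next
        case 3
        then show ?thesis using \<open>R l (h l)\<close> h'[OF l] by simp
      qed
    qed
    ultimately have IH: "(perm_act X h' m, m) \<in> r" using less.hyps h'B by blast
    have "h = compose X (transposition_on X i k) h'"
    proof (rule Bij_eqI[OF hB compose_Bij[OF transp_Bij[OF i(1) k(1)] h'B]])
      fix l assume l: "l \<in> X"
      then show "h l = compose X (transposition_on X i k) h' l"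
        using Bij_mem[OF h'B l] h'[OF l] by (simp add: compose_eq)
    qed
    then have "perm_act X h m = perm_act X (transposition_on X i k) (perm_act X h' m)"
      using perm_act_compose[OF transp_Bij[OF i(1) k(1)] h'B mX] by simp
    moreover have "(perm_act X (transposition_on X i k) (perm_act X h' m), perm_act X h' m) \<in> r"
    proof (rule transp_act_le[OF perm_act_monomials[OF h'B mX] i(1) k(1)])
      show "var_le k i" using max k by blast
      have "h j \<noteq> j" using j i Bij_eq_iff[OF hB] by auto
      then have "var_le j i" using max j by blast
      moreover have "R i j" using R(1)[OF hR[OF j(1)]] j(2) by simp
      ultimately have "Poly_Mapping.lookup m j \<le> Poly_Mapping.lookup m i"
        using m by (auto simp: sorted_monomials_def)
      then show "Poly_Mapping.lookup (perm_act X h' m) k \<le> Poly_Mapping.lookup (perm_act X h' m) i"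
        using lookup_perm_act[OF h'B mX] h'i i j by metis
    qed
    ultimately show ?thesis using IH order_trans by metis
  qed
qed

text \<open>The generators are the squarefree sorted monomials, at most one for each subset of
  \<open>X\<close>. The support of a sorted monomial is itself sorted, and dividing by it lowers
  every nonzero exponent by 1, which preserves sortedness.\<close>

lemma sorted_monomials_finitely_generated:
  assumes R: "\<And>i j. R i j \<Longrightarrow> i \<in> X \<and> j \<in> X"
  shows "\<exists>S. finite S \<and> S \<subseteq> sorted_monomials R \<and> sorted_monomials R \<subseteq> monoid_generated S"
proof -
  define S where "S = sorted_monomials R \<inter> (\<lambda>Y. monomial_of Y (\<lambda>_. 1)) ` Pow X"
  have "m \<in> monoid_generated S" if "m \<in> sorted_monomials R" for m
    using that
  proof (induction "\<Sum>i\<in>X. Poly_Mapping.lookup m i" arbitrary: m rule: less_induct)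
    case less
    then have mX: "m \<in> monomials X"
      and ms: "\<And>i j. R i j \<Longrightarrow> var_le j i \<Longrightarrow> Poly_Mapping.lookup m j \<le> Poly_Mapping.lookup m i"
      by (auto simp: sorted_monomials_def)
    show ?case
    proof (cases "m = 0")
      case True
      then show ?thesis by (simp add: monoid_generated.zero)
    next
      case False
      then obtain k where k: "k \<in> Poly_Mapping.keys m" by (metis keys_eq_empty_nat ex_in_conv)
      then have kX: "k \<in> X" using mX by (auto simp: monomials_def)
      define c where "c = monomial_of (Poly_Mapping.keys m) (\<lambda>_. 1)"
      define m' where "m' = m - c"
      have cl: "Poly_Mapping.lookup c i = (if Poly_Mapping.lookup m i = 0 then 0 else 1)" for i
        by (simp add: c_def lookup_monomial_of in_keys_iff)
      have m'l: "Poly_Mapping.lookup m' i = Poly_Mapping.lookup m i - 1" for i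
        by (simp add: m'_def lookup_minus cl)
      have "c \<in> sorted_monomials R"
        unfolding sorted_monomials_def mem_Collect_eq
      proof (intro conjI allI impI)
        show "c \<in> monomials X" using mX by (auto simp: monomials_def in_keys_iff cl split: if_splits)
        fix i j assume "R i j" "var_le j i"
        then show "Poly_Mapping.lookup c j \<le> Poly_Mapping.lookup c i" using ms[of i j] by (simp add: cl)
      qed
      then have c: "c \<in> S" using mX by (auto simp: S_def c_def monomials_def)
      have "m' \<in> sorted_monomials R"
        unfolding sorted_monomials_def mem_Collect_eq
      proof (intro conjI allI impI)
        show "m' \<in> monomials X" using mX by (auto simp: monomials_def in_keys_iff m'l subset_iff)
        fix i j assume "R i j" "var_le j i"
        then show "Poly_Mapping.lookup m' j \<le> Poly_Mapping.lookup m' i" using ms[of i j] by (simp add: m'l)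
      qed
      moreover have "Poly_Mapping.lookup m' k < Poly_Mapping.lookup m k"
        using k by (simp add: m'l in_keys_iff)
      then have "(\<Sum>i\<in>X. Poly_Mapping.lookup m' i) < (\<Sum>i\<in>X. Poly_Mapping.lookup m i)"
        using kX finite_X by (intro sum_strict_mono_ex1) (auto simp: m'l)
      ultimately have m': "m' \<in> monoid_generated S" using less.hyps by blast
      have "m = c + m'"
        by (intro poly_mapping_eqI) (simp add: lookup_add m'l cl)
      then show ?thesis using m' c by (metis monoid_generated.add monoid_generated.base)
    qed
  qed
  moreover have "finite S" using finite_X by (simp add: S_def)
  ultimately show ?thesis by (auto simp: S_def)
qed

lemma orbit_restrictions:
  assumes G: "G = restrictions X H" and m: "m \<in> monomials X"
  shows "orbit G m = (\<lambda>h. perm_act X h m) ` H"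
proof (intro equalityI subsetI)
  fix m' assume "m' \<in> orbit G m"
  then obtain f where f: "f \<in> G" "Poly_Mapping.keys m \<subseteq> dom f" "m' = act f m"
    by (auto simp: orbit_def)
  then obtain h Y where h: "h \<in> H" "f = (Some \<circ> h) |` Y" "Y \<subseteq> X" using G by (auto simp: restrictions_def)
  then have "m' = perm_act X h m"
    unfolding f(3) perm_act_def using f m
    by (intro act_cong) (auto simp: monomials_def restrict_map_def subset_iff split: if_splits)
  then show "m' \<in> (\<lambda>h. perm_act X h m) ` H" using h by blast
next
  fix m' assume "m' \<in> (\<lambda>h. perm_act X h m) ` H"
  then obtain h where h: "h \<in> H" "m' = act ((Some \<circ> h) |` X) m" by (auto simp: perm_act_def)
  moreover have "(Some \<circ> h) |` X \<in> G" using G h by (auto simp: restrictions_def)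
  moreover have "Poly_Mapping.keys m \<subseteq> dom ((Some \<circ> h) |` X)"
    using m by (simp add: dom_Some_restrict monomials_def)
  ultimately show "m' \<in> orbit G m" unfolding orbit_def by blast
qed

text \<open>Here \<open>M\<close> is the set of sorted monomials for the relation
  \<open>linked X H\<close>: transpositions force maximal monomials to be sorted, and elements of
  \<open>H\<close> only move variables to linked ones.\<close>

lemma generated_by_transpositions_finitely_generated:
  assumes H: "subgroup H (BijGroup X)" "generated_by_transpositions X H" and G: "G = restrictions X H"
  shows "\<exists>S. finite S \<and> monoid_generated S = M"
proof -
  obtain T where T: "T \<subseteq> transpositions X" "H = generate (BijGroup X) T"
    using H(2) by (auto simp: generated_by_transpositions_def)
  have HB: "H \<subseteq> Bij X" using H(1) subgroup.subset carrier_BijGroup by blast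
  let ?R = "linked X H"
  have "M = sorted_monomials ?R"
  proof (intro equalityI subsetI)
    fix m assume m: "m \<in> M"
    then have mX: "m \<in> monomials X" by (simp add: maximal_monomials_def)
    have "Poly_Mapping.lookup m j \<le> Poly_Mapping.lookup m i" if "?R i j" "var_le j i" for i j
    proof (rule ccontr)
      assume less: "\<not> Poly_Mapping.lookup m j \<le> Poly_Mapping.lookup m i"
      then have t: "i \<in> X" "j \<in> X" "transposition_on X i j \<in> H" using that by (auto simp: linked_def)
      let ?t = "transposition_on X i j"
      have tB: "?t \<in> Bij X" using t HB by auto
      let ?m = "perm_act X ?t m"
      have l: "Poly_Mapping.lookup ?m i = Poly_Mapping.lookup m j"
        "Poly_Mapping.lookup ?m j = Poly_Mapping.lookup m i"
        using lookup_perm_act[OF tB mX, of i] lookup_perm_act[OF tB mX, of j] t by simp_all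
      have mX': "?m \<in> monomials X" using tB mX by (rule perm_act_monomials)
      \<comment> \<open>In \<open>?m\<close> the larger variable \<open>i\<close> has the larger
        exponent, so the transposition taking \<open>?m\<close> back to \<open>m\<close> does not
        increase it. Maximality of \<open>m\<close> gives the opposite inequality, although the two
        monomials differ at \<open>i\<close>.\<close>
      have "perm_act X ?t ?m = m"
      proof (rule perm_act_eqI[OF tB mX' mX])
        fix l assume l: "l \<in> X"
        have tl: "?t (?t l) = l" "?t l \<in> X" using l t by (auto simp: Transposition.transpose_def)
        then show "Poly_Mapping.lookup m (?t l) = Poly_Mapping.lookup ?m l"
          using lookup_perm_act[OF tB mX tl(2)] by metis
      qed
      moreover have "(perm_act X ?t ?m, ?m) \<in> r"
        using l less that t by (intro transp_act_le[OF mX']) auto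
      moreover have "(?m, m) \<in> r"
        using m t orbit_restrictions[OF G mX] by (auto simp: maximal_monomials_def)
      ultimately have "?m = m" using order_antisym by metis
      then show False using l less by simp
    qed
    then show "m \<in> sorted_monomials ?R" using mX by (auto simp: sorted_monomials_def)
  next
    fix m assume m: "m \<in> sorted_monomials ?R"
    then have mX: "m \<in> monomials X" by (simp add: sorted_monomials_def)
    have "(perm_act X h m, m) \<in> r" if h: "h \<in> H" for h
    proof (rule sorted_perm_act_le[OF _ _ m])
      show "?R i j \<Longrightarrow> ?R j i" for i j by (rule linked_sym)
      show "?R i j \<Longrightarrow> ?R j k \<Longrightarrow> ?R i k" for i j k using linked_trans[OF H(1)] by blast
      show "h \<in> Bij X" using h HB by blast
      show "i \<in> X \<Longrightarrow> ?R i (h i)" for i using linked_generate[OF T(1)] h T(2) by blast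
    qed
    then show "m \<in> M" using mX orbit_restrictions[OF G mX] by (auto simp: maximal_monomials_def)
  qed
  moreover obtain S where S: "finite S" "S \<subseteq> sorted_monomials ?R"
    "sorted_monomials ?R \<subseteq> monoid_generated S"
    using sorted_monomials_finitely_generated[of ?R] by (auto simp: linked_def)
  moreover have "monoid_generated S \<subseteq> M"
    using calculation monoid_generated_maximal[of S] by auto
  ultimately have "monoid_generated S = M" by auto
  then show ?thesis using S(1) by blast
qed

end

section \<open>Finitely generated monoids of maximal monomials\<close>

definition monomial_power :: "nat \<Rightarrow> 'a monomial \<Rightarrow> 'a monomial" where
  "monomial_power n m = (\<Sum>_<n. m)"

lemma lookup_monomial_power:
  "Poly_Mapping.lookup (monomial_power n m) i = n * Poly_Mapping.lookup m i"
  by (simp add: monomial_power_def lookup_sum)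

lemma keys_monomial_power: "Poly_Mapping.keys (monomial_power n m) \<subseteq> Poly_Mapping.keys m"
  by (auto simp: in_keys_iff lookup_monomial_power)

lemma monomial_power_Suc: "monomial_power (Suc n) m = m + monomial_power n m"
  by (simp add: monomial_power_def add.commute)

lemma monomial_power_monomials: "m \<in> monomials X \<Longrightarrow> monomial_power n m \<in> monomials X"
  by (auto simp: monomials_def in_keys_iff lookup_monomial_power)

lemma monomial_power_eq_iff: "n > 0 \<Longrightarrow> monomial_power n s = monomial_power n t \<longleftrightarrow> s = t"
  by (auto simp: poly_mapping_eq_iff fun_eq_iff lookup_monomial_power)

lemma act_monomial_power:
  assumes "inj_on f (dom f)" "Poly_Mapping.keys m \<subseteq> dom f"
  shows "act f (monomial_power n m) = monomial_power n (act f m)"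
proof (induction n)
  case 0
  then show ?case by (simp add: monomial_power_def act_def)
next
  case (Suc n)
  have "Poly_Mapping.keys (monomial_power n m) \<subseteq> dom f"
    using keys_monomial_power assms(2) by (rule subset_trans)
  then show ?case using Suc act_add[OF assms] by (simp add: monomial_power_Suc)
qed

lemma perm_act_monomial_power:
  "h \<in> Bij X \<Longrightarrow> m \<in> monomials X \<Longrightarrow>
    perm_act X h (monomial_power n m) = monomial_power n (perm_act X h m)"
  unfolding perm_act_def
  by (intro act_monomial_power inj_Some_restrict) (auto simp: dom_Some_restrict monomials_def)

context ordered_perm_groupoid
begin

lemma maximal_monomials_subset: "m \<in> M \<Longrightarrow> m \<in> monomials X"
  by (simp add: maximal_monomials_def)

lemma maximal_power: "m \<in> M \<Longrightarrow> monomial_power n m \<in> M"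
  by (induction n) (simp_all add: monomial_power_Suc maximal_add, simp add: monomial_power_def maximal_zero)

lemma order_power: "(s, t) \<in> r \<Longrightarrow> (monomial_power n s, monomial_power n t) \<in> r"
  by (induction n) (simp_all add: monomial_power_Suc order_add_mono, simp add: monomial_power_def order_refl)

text \<open>A larger monomial in the orbit of \<open>m\<close> would have a power in the orbit of
  \<open>monomial_power n m\<close> that is at least as large. Maximality makes the two powers
  equal, and roots are unique.\<close>

lemma maximal_power_cancel:
  assumes n: "n > 0" and m: "m \<in> monomials X" and max: "monomial_power n m \<in> M"
  shows "m \<in> M"
proof -
  have "(m', m) \<in> r" if m': "m' \<in> orbit G m" for m'
  proof (rule ccontr)
    assume "(m', m) \<notin> r"
    then have "(m, m') \<in> r" using m orbit_monomials[OF m'] order_total by blast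
    then have 1: "(monomial_power n m, monomial_power n m') \<in> r" by (rule order_power)
    obtain f where f: "f \<in> G" "Poly_Mapping.keys m \<subseteq> dom f" "m' = act f m"
      using m' by (auto simp: orbit_def)
    have "Poly_Mapping.keys (monomial_power n m) \<subseteq> dom f"
      using keys_monomial_power f(2) by (rule subset_trans)
    then have "monomial_power n m' \<in> orbit G (monomial_power n m)"
      using f(1,3) act_monomial_power[OF inj_on_dom[OF f(1)] f(2), of n]
      unfolding orbit_def mem_Collect_eq by metis
    then have "(monomial_power n m', monomial_power n m) \<in> r"
      using max by (simp add: maximal_monomials_def)
    then have "monomial_power n m = monomial_power n m'" using 1 order_antisym by blast
    then have "m = m'" using n by (simp add: monomial_power_eq_iff)
    then show False using \<open>(m', m) \<notin> r\<close> m order_refl by simp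
  qed
  then show ?thesis using m by (simp add: maximal_monomials_def)
qed

section \<open>The permutations of all of \<open>X\<close> that belong to \<open>G\<close>\<close>

text \<open>The only candidate for \<open>H\<close>: a subgroup \<open>H\<close> of
  \<open>BijGroup X\<close> with \<open>G = restrictions X H\<close> consists of exactly these
  permutations.\<close>

definition full_perms :: "('a \<Rightarrow> 'a) set" where
  "full_perms = {h \<in> Bij X. (Some \<circ> h) |` X \<in> G}"

lemma full_perms_Bij: "h \<in> full_perms \<Longrightarrow> h \<in> Bij X"
  by (simp add: full_perms_def)

lemma full_perms_compose:
  assumes "g \<in> full_perms" "h \<in> full_perms"
  shows "compose X g h \<in> full_perms"
proof -
  have B: "g \<in> Bij X" "h \<in> Bij X" using assms by (auto simp: full_perms_def)
  have "h ` X = X" using B by (auto simp: Bij_def bij_betw_def)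
  then have "ran ((Some \<circ> h) |` X) = dom ((Some \<circ> g) |` X)"
    by (simp add: ran_Some_restrict dom_Some_restrict)
  then have "(Some \<circ> g) |` X \<circ>\<^sub>m (Some \<circ> h) |` X \<in> G"
    using assms by (intro map_comp_mem) (auto simp: full_perms_def)
  also have "(Some \<circ> g) |` X \<circ>\<^sub>m (Some \<circ> h) |` X = (Some \<circ> compose X g h) |` X"
    using Bij_mem[OF B(2)] by (auto simp: fun_eq_iff restrict_map_def map_comp_def compose_def)
  finally show ?thesis using B by (simp add: full_perms_def compose_Bij)
qed

lemma full_perms_inv:
  assumes "h \<in> full_perms"
  shows "inv\<^bsub>BijGroup X\<^esub> h \<in> full_perms"
proof -
  have hB: "h \<in> Bij X" using assms by (simp add: full_perms_def)
  note i = inv_BijGroup[OF hB]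
  have "local_inverse ((Some \<circ> h) |` X) = (Some \<circ> inv\<^bsub>BijGroup X\<^esub> h) |` X"
  proof
    fix y
    show "local_inverse ((Some \<circ> h) |` X) y = ((Some \<circ> inv\<^bsub>BijGroup X\<^esub> h) |` X) y"
    proof (cases "y \<in> X")
      case True
      have "((Some \<circ> h) |` X) ((inv\<^bsub>BijGroup X\<^esub> h) y) = Some y"
        using True i(3) Bij_mem[OF i(1) True] by simp
      then show ?thesis using local_inverse_Some[OF inj_Some_restrict[OF hB]] True by simp
    next
      case False
      then have "y \<notin> ran ((Some \<circ> h) |` X)"
        using Bij_mem[OF hB] by (auto simp: ran_Some_restrict)
      then show ?thesis using False by (simp add: local_inverse_def)
    qed
  qed
  then show ?thesis
    using local_inverse_mem[of "(Some \<circ> h) |` X"] assms i(1) by (simp add: full_perms_def)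
qed

lemma full_perms_one: "\<one>\<^bsub>BijGroup X\<^esub> \<in> full_perms"
proof -
  have "(Some \<circ> (\<lambda>x\<in>X. x)) |` X = Some |` X" by (auto simp: fun_eq_iff restrict_map_def)
  then show ?thesis using id_mem id_Bij by (simp add: full_perms_def one_BijGroup)
qed

lemma subgroup_full_perms: "subgroup full_perms (BijGroup X)"
  by (rule subgroup.intro)
    (auto simp: carrier_BijGroup mult_BijGroup full_perms_Bij full_perms_compose full_perms_one full_perms_inv)

lemma finite_full_perms: "finite full_perms"
proof (rule finite_imageD)
  show "finite ((\<lambda>h. (Some \<circ> h) |` X) ` full_perms)"
    using finite_G by (rule finite_subset[rotated]) (auto simp: full_perms_def)
  show "inj_on (\<lambda>h. (Some \<circ> h) |` X) full_perms"
  proof (rule inj_onI)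
    fix g h assume gh: "g \<in> full_perms" "h \<in> full_perms" "(Some \<circ> g) |` X = (Some \<circ> h) |` X"
    show "g = h"
    proof (rule Bij_eqI[OF full_perms_Bij[OF gh(1)] full_perms_Bij[OF gh(2)]])
      fix i assume "i \<in> X"
      then show "g i = h i" using fun_cong[OF gh(3), of i] by simp
    qed
  qed
qed

lemma perm_act_orbit:
  assumes "h \<in> full_perms" "m \<in> monomials X"
  shows "perm_act X h m \<in> orbit G m"
proof -
  have "(Some \<circ> h) |` X \<in> G" "Poly_Mapping.keys m \<subseteq> dom ((Some \<circ> h) |` X)"
    using assms by (simp_all add: full_perms_def dom_Some_restrict monomials_def)
  then show ?thesis unfolding orbit_def perm_act_def by blast
qed

text \<open>A local bijection that makes \<open>m\<close> maximal may be chosen with the support of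
  \<open>m\<close> as its domain. That is all of \<open>X\<close>, and an injective self-map of a
  finite set is a permutation.\<close>

lemma full_support_maximal:
  assumes "Poly_Mapping.keys m = X"
  shows "\<exists>h\<in>full_perms. perm_act X h m \<in> M"
proof -
  have "m \<in> monomials X" using assms by (simp add: monomials_def)
  then obtain m' where m': "m' \<in> orbit G m" "m' \<in> M" by (rule maximal_in_orbit)
  then obtain f where f: "f \<in> G" "dom f = X" "m' = act f m"
    using orbitE assms by metis
  define h where "h = (\<lambda>x\<in>X. the (f x))"
  have fh: "(Some \<circ> h) |` X = f"
  proof
    fix x
    show "((Some \<circ> h) |` X) x = f x"
      using f(2) by (cases "x \<in> X") (auto simp: h_def restrict_map_def)
  qed
  have "inj_on h X"
  proof (rule inj_onI)
    fix x y assume xy: "x \<in> X" "y \<in> X" "h x = h y"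
    then have "f x = f y" unfolding fh[symmetric] by simp
    then show "x = y" using inj_on_dom[OF f(1)] f(2) xy by (auto dest: inj_onD)
  qed
  moreover have "h ` X \<subseteq> X" using ran_subset[OF f(1)] unfolding fh[symmetric] ran_Some_restrict .
  ultimately have "bij_betw h X X" using endo_inj_surj[OF finite_X] by (auto simp: bij_betw_def)
  then have "h \<in> full_perms" using f(1) fh by (simp add: full_perms_def Bij_def h_def)
  then show ?thesis using m'(2) f(3) fh by (auto simp: perm_act_def)
qed

text \<open>Both images are the unique maximal monomial of the orbit, so the two permutations differ
  by one that fixes \<open>m\<close>.\<close>

lemma maximal_perm_unique:
  assumes "g \<in> full_perms" "h \<in> full_perms" "m \<in> monomials X"
    and "perm_act X g m \<in> M" "perm_act X h m \<in> M"
  shows "perm_act X (compose X (inv\<^bsub>BijGroup X\<^esub> g) h) m = m"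
proof -
  have "perm_act X h m \<in> orbit G (perm_act X g m)"
    using assms perm_act_orbit orbit_sym orbit_trans by blast
  then have "perm_act X h m = perm_act X g m" using maximal_unique assms(4,5) by blast
  then show ?thesis
    using assms full_perms_Bij perm_act_compose[OF inv_BijGroup(1)] perm_act_inv(1) by metis
qed

section \<open>Cosets of the group generated by the transpositions in \<open>G\<close>\<close>

definition transposition_group :: "('a \<Rightarrow> 'a) set" where
  "transposition_group = generate (BijGroup X) (transpositions X \<inter> full_perms)"

lemma transpositions_carrier: "transpositions X \<inter> full_perms \<subseteq> carrier (BijGroup X)"
  by (auto simp: carrier_BijGroup full_perms_Bij)

lemma subgroup_transposition_group: "subgroup transposition_group (BijGroup X)"
  unfolding transposition_group_def
  by (rule group.generate_is_subgroup[OF group_BijGroup transpositions_carrier])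

lemma transposition_group_subset: "transposition_group \<subseteq> full_perms"
  unfolding transposition_group_def
  by (rule group.generate_subgroup_incl[OF group_BijGroup _ subgroup_full_perms]) simp

text \<open>Only one pair of variables can share an exponent, so it is the only pair that can be moved.\<close>

lemma stabilizer_transposition_group:
  assumes u: "u \<in> full_perms" and m: "m \<in> monomials X" and um: "perm_act X u m = m"
    and inj: "inj_on (Poly_Mapping.lookup m) (X - {i})"
  shows "u \<in> transposition_group"
proof -
  have uB: "u \<in> Bij X" using u by (rule full_perms_Bij)
  note uX = Bij_mem[OF uB] and u_inj = Bij_eq_iff[OF uB]
  have eq: "Poly_Mapping.lookup m (u l) = Poly_Mapping.lookup m l" if "l \<in> X" for l
    using lookup_perm_act[OF uB m that] um by simp
  \<comment> \<open>The variables \<open>l\<close> and \<open>u l\<close> have the same exponent,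
    and away from \<open>i\<close> the exponents are distinct.\<close>
  have fixed: "u l = l" if "l \<in> X" "l \<noteq> i" "u l \<noteq> i" for l
    using inj_onD[OF inj eq[OF that(1)]] that uX by simp
  show ?thesis
  proof (cases "\<forall>l\<in>X. u l = l")
    case True
    then have "u = (\<lambda>x\<in>X. x)" using uB id_Bij by (intro Bij_eqI) auto
    then show ?thesis
      using generate.one[of "BijGroup X"] by (simp add: transposition_group_def one_BijGroup)
  next
    case False
    then obtain l where l: "l \<in> X" "u l \<noteq> l" by blast
    then have iX: "i \<in> X" using fixed uX by metis
    define j where "j = u i"
    have jX: "j \<in> X" using iX uX by (simp add: j_def)
    have ji: "j \<noteq> i"
    proof
      assume "j = i"
      then have "l \<noteq> i" "u l \<noteq> i" using l iX u_inj[of l i] by (auto simp: j_def)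
      then show False using fixed l by blast
    qed
    obtain k where k: "k \<in> X" "u k = i" using Bij_surj[OF uB iX] by blast
    have "k \<noteq> i" using k ji by (auto simp: j_def)
    \<comment> \<open>Under \<open>u\<close> the variable \<open>k\<close> goes to \<open>i\<close>
      and \<open>i\<close> goes to \<open>j\<close>, so all three share one exponent. As
      \<open>k\<close> and \<open>j\<close> both differ from \<open>i\<close>, they coincide, and
      \<open>u\<close> swaps \<open>i\<close> and \<open>j\<close>.\<close>
    moreover have "Poly_Mapping.lookup m k = Poly_Mapping.lookup m j"
      using eq[OF k(1)] eq[OF iX] k(2) by (simp add: j_def)
    ultimately have "k = j" using inj_onD[OF inj] k jX ji by simp
    have "u = transposition_on X i j"
    proof (rule Bij_eqI[OF uB transp_Bij[OF iX jX]])
      fix x assume x: "x \<in> X"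
      consider "x = i" | "x = j" | "x \<noteq> i" "x \<noteq> j" by blast
      then show "u x = transposition_on X i j x"
      proof cases
        case 3
        then have "u x \<noteq> i" using u_inj[OF x k(1)] k(2) \<open>k = j\<close> by simp
        then show ?thesis using 3 fixed x by simp
      qed (use x k \<open>k = j\<close> iX in \<open>auto simp: j_def\<close>)
    qed
    then have "u \<in> transpositions X \<inter> full_perms"
      using u iX jX ji by (auto simp: transpositions_def)
    then show ?thesis unfolding transposition_group_def by (rule generate.incl)
  qed
qed

text \<open>Equality of the left cosets of \<open>g\<close> and \<open>h\<close> modulo
  \<open>transposition_group\<close>.\<close>

definition same_coset :: "('a \<Rightarrow> 'a) \<Rightarrow> ('a \<Rightarrow> 'a) \<Rightarrow> bool" where
  "same_coset g h \<longleftrightarrow> inv\<^bsub>BijGroup X\<^esub> g \<otimes>\<^bsub>BijGroup X\<^esub> h \<in> transposition_group"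

lemma same_coset_trans:
  assumes "f \<in> full_perms" "g \<in> full_perms" "h \<in> full_perms" "same_coset f g" "same_coset g h"
  shows "same_coset f h"
proof -
  interpret group "BijGroup X" by (rule group_BijGroup)
  have c: "f \<in> carrier (BijGroup X)" "g \<in> carrier (BijGroup X)" "h \<in> carrier (BijGroup X)"
    using assms full_perms_Bij by (auto simp: carrier_BijGroup)
  have "(inv\<^bsub>BijGroup X\<^esub> f \<otimes>\<^bsub>BijGroup X\<^esub> g) \<otimes>\<^bsub>BijGroup X\<^esub> (inv\<^bsub>BijGroup X\<^esub> g \<otimes>\<^bsub>BijGroup X\<^esub> h) \<in> transposition_group"
    using assms subgroup.m_closed[OF subgroup_transposition_group] by (simp add: same_coset_def)
  then show ?thesis using c by (simp add: same_coset_def m_assoc) (simp add: inv_solve_left flip: m_assoc)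
qed

lemma maximal_same_coset:
  assumes "g \<in> full_perms" "h \<in> full_perms" "m \<in> monomials X"
    and "perm_act X g m \<in> M" "perm_act X h m \<in> M"
    and "inj_on (Poly_Mapping.lookup m) (X - {i})"
  shows "same_coset g h"
proof -
  have "compose X (inv\<^bsub>BijGroup X\<^esub> g) h \<in> transposition_group"
    using assms full_perms_compose[OF full_perms_inv] maximal_perm_unique
    by (intro stabilizer_transposition_group) auto
  then show ?thesis
    using assms(1,2) full_perms_inv full_perms_Bij by (simp add: same_coset_def mult_BijGroup)
qed

end

section \<open>Consequences of finite generation\<close>

locale finitely_generated_maximal = ordered_perm_groupoid +
  fixes S
  assumes finite_S: "finite S" and generated: "monoid_generated S = M"
begin

text \<open>By Dickson's lemma there are two indices whose permutations agree and whose
  factorizations into generators are nested. The remaining generators multiply to an element of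
  \<open>M\<close>, so the common permutation also makes the quotient \<open>w\<close> maximal.
  Further quantities to be kept monotone enter through \<open>F\<close>.\<close>

lemma good_pair:
  fixes k :: "nat \<Rightarrow> 'a \<Rightarrow> 'a" and x :: "nat \<Rightarrow> 'a monomial" and F :: "(nat \<Rightarrow> nat) set"
  assumes k: "\<And>n. k n \<in> full_perms" and x: "\<And>n. x n \<in> monomials X"
    and max: "\<And>n. perm_act X (k n) (x n) \<in> M" and F: "finite F"
  shows "\<exists>n n' w. n < n' \<and> (\<forall>f\<in>F. f n \<le> f n') \<and>
    x n' = x n + w \<and> k n' = k n \<and> perm_act X (k n') w \<in> M"
proof -
  have "\<exists>N. set_mset N \<subseteq> S \<and> perm_act X (k n) (x n) = \<Sum>\<^sub># N" for n
    using max generated mem_monoid_generated_iff by blast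
  then obtain N where N: "\<And>n. set_mset (N n) \<subseteq> S" "\<And>n. perm_act X (k n) (x n) = \<Sum>\<^sub># (N n)"
    by metis
  \<comment> \<open>The indicator functions express equality of permutations by monotonicity: the
    indicator of \<open>k n\<close> is 1 at \<open>n\<close>, hence also at
    \<open>n'\<close>.\<close>
  define F' where "F' = F \<union> (\<lambda>s n. count (N n) s) ` S \<union> (\<lambda>g n. if k n = g then 1 else 0) ` full_perms"
  have "finite F'" using F finite_S finite_full_perms by (simp add: F'_def)
  then obtain \<phi> :: "nat \<Rightarrow> nat" where \<phi>: "strict_mono \<phi>" "\<forall>f\<in>F'. mono (f \<circ> \<phi>)"
    using dickson by blast
  define n n' where "n = \<phi> 0" and "n' = \<phi> 1"
  have le: "f n \<le> f n'" if "f \<in> F'" for f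
    using \<phi>(2) that monoD[of "f \<circ> \<phi>" 0 1] by (simp add: n_def n'_def)
  have kk: "k n' = k n"
    using le[of "\<lambda>m. if k m = k n then 1 else 0"] k[of n] by (auto simp: F'_def split: if_splits)
  have "N n \<subseteq># N n'"
  proof (rule mset_subset_eqI)
    fix s
    show "count (N n) s \<le> count (N n') s"
    proof (cases "s \<in> S")
      case True
      then show ?thesis using le[of "\<lambda>n. count (N n) s"] by (simp add: F'_def)
    next
      case False
      then have "s \<notin># N n" using N(1) by blast
      then show ?thesis by (simp add: not_in_iff)
    qed
  qed
  then obtain D where D: "N n' = N n + D" by (metis subset_mset.le_iff_add)
  have DM: "\<Sum>\<^sub># D \<in> M"
  proof -
    have "set_mset D \<subseteq> S" using N(1)[of n'] D by auto
    then show ?thesis using generated mem_monoid_generated_iff by blast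
  qed
  have kB: "k n \<in> Bij X" using k full_perms_Bij by blast
  note iB = inv_BijGroup(1)[OF kB]
  have DX: "\<Sum>\<^sub># D \<in> monomials X" using DM by (rule maximal_monomials_subset)
  define w where "w = perm_act X (inv\<^bsub>BijGroup X\<^esub> (k n)) (\<Sum>\<^sub># D)"
  have wX: "w \<in> monomials X" unfolding w_def using iB DX by (rule perm_act_monomials)
  have kw: "perm_act X (k n) w = \<Sum>\<^sub># D" unfolding w_def using kB DX by (rule perm_act_inv)
  have "perm_act X (k n) (x n') = perm_act X (k n) (x n + w)"
    using N(2)[of n'] N(2)[of n] kk D kw perm_act_add[OF kB x wX] by simp
  then have "x n' = x n + w"
    using perm_act_inv(1)[OF kB] x wX by (metis add_monomials)
  moreover have "n < n'" using strict_monoD[OF \<phi>(1), of 0 1] by (simp add: n_def n'_def)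
  moreover have "f n \<le> f n'" if "f \<in> F" for f using le that by (simp add: F'_def)
  moreover have "perm_act X (k n') w \<in> M" using kw DM kk by simp
  ultimately show ?thesis using kk by blast
qed

text \<open>
  The cone spanned by the maximal monomials is closed: a monomial \<open>a\<close> is the limit of
  \<open>a\<^sup>n\<cdot>\<Prod>X\<close> as \<open>n\<close> grows, and the latter have full support.
\<close>

lemma maximal_perm_exists:
  assumes a: "a \<in> monomials X"
  shows "\<exists>k\<in>full_perms. perm_act X k a \<in> M"
proof -
  define x where "x n = monomial_power n a + monomial_of X (\<lambda>_. 1)" for n
  have xl: "Poly_Mapping.lookup (x n) i = n * Poly_Mapping.lookup a i + (if i \<in> X then 1 else 0)" for n i
    by (simp add: x_def lookup_add lookup_monomial_power lookup_monomial_of finite_X)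
  have xX: "x n \<in> monomials X" for n
    using a finite_X by (simp add: x_def monomial_power_monomials monomial_of_monomials)
  have "Poly_Mapping.keys (x n) = X" for n
    using a monomials_lookup_eq_0[OF a] by (auto simp: in_keys_iff xl split: if_splits)
  then have "\<forall>n. \<exists>k. k \<in> full_perms \<and> perm_act X k (x n) \<in> M"
    using full_support_maximal by blast
  then obtain k where k: "\<And>n. k n \<in> full_perms" "\<And>n. perm_act X (k n) (x n) \<in> M" by metis
  obtain n n' w where w: "n < n'" "x n' = x n + w" "perm_act X (k n') w \<in> M"
    using good_pair[of k x "{}"] k xX by auto
  \<comment> \<open>The product of all variables cancels in the quotient and leaves a pure power of
    \<open>a\<close>, of which \<open>maximal_power_cancel\<close> takes the root.\<close>
  have "w = monomial_power (n' - n) a"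
  proof (rule poly_mapping_eqI)
    fix i
    have "Poly_Mapping.lookup (x n') i = Poly_Mapping.lookup (x n) i + Poly_Mapping.lookup w i"
      using w(2) by (simp add: lookup_add)
    then show "Poly_Mapping.lookup w i = Poly_Mapping.lookup (monomial_power (n' - n) a) i"
      using w(1) by (simp add: xl lookup_monomial_power diff_mult_distrib)
  qed
  then have "monomial_power (n' - n) (perm_act X (k n') a) \<in> M"
    using w(3) perm_act_monomial_power[OF full_perms_Bij[OF k(1)] a] by simp
  then have "perm_act X (k n') a \<in> M"
    using maximal_power_cancel[of "n' - n"] w(1) perm_act_monomials[OF full_perms_Bij[OF k(1)] a] by simp
  then show ?thesis using k(1) by blast
qed

text \<open>A monomial \<open>a\<close> with distinct exponents on the domain of \<open>f\<close>
  detects \<open>f\<close>. If \<open>g\<close> maximizes \<open>a\<close> and \<open>h\<close>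
  maximizes its image \<open>b\<close> under \<open>f\<close>, both lead to the same monomial, so
  \<open>g\<close> followed by the inverse of \<open>h\<close> agrees with \<open>f\<close> on this
  domain.\<close>

lemma groupoid_eq_restrictions: "G = restrictions X full_perms"
proof (intro equalityI subsetI)
  fix f assume "f \<in> restrictions X full_perms"
  then obtain h Y where h: "h \<in> full_perms" "Y \<subseteq> X" "f = (Some \<circ> h) |` Y"
    by (auto simp: restrictions_def)
  then have "f = ((Some \<circ> h) |` X) |` Y" by (simp add: inf.absorb2)
  then show "f \<in> G" using h restrict_mem[of "(Some \<circ> h) |` X" Y]
    by (simp add: full_perms_def dom_Some_restrict)
next
  fix f assume f: "f \<in> G"
  define Y where "Y = dom f"
  have YX: "Y \<subseteq> X" and fY: "finite Y"
    using dom_subset[OF f] finite_X finite_subset by (auto simp: Y_def)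
  obtain e :: "'a \<Rightarrow> nat" where e: "inj_on e Y"
    using finite_imp_inj_to_nat_seg[OF fY] by blast
  \<comment> \<open>\<open>Suc\<close> makes the exponents positive, so that the support is all of
    \<open>Y\<close>.\<close>
  define a where "a = monomial_of Y (Suc \<circ> e)"
  have al: "Poly_Mapping.lookup a i = (if i \<in> Y then Suc (e i) else 0)" for i
    by (simp add: a_def lookup_monomial_of fY)
  have keys: "Poly_Mapping.keys a = Y" by (auto simp: in_keys_iff al split: if_splits)
  have aX: "a \<in> monomials X" using keys YX by (simp add: monomials_def)
  define b where "b = act f a"
  have b: "b \<in> orbit G a" using f keys by (auto simp: b_def orbit_def Y_def)
  have bX: "b \<in> monomials X" using b by (rule orbit_monomials)
  obtain g h where gh: "g \<in> full_perms" "perm_act X g a \<in> M" "h \<in> full_perms" "perm_act X h b \<in> M"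
    using maximal_perm_exists aX bX by blast
  have gB: "g \<in> Bij X" and hB: "h \<in> Bij X" using gh full_perms_Bij by auto
  have "perm_act X h b \<in> orbit G (perm_act X g a)"
    using perm_act_orbit[OF gh(1) aX] perm_act_orbit[OF gh(3) bX] b orbit_sym orbit_trans by blast
  then have eq: "perm_act X h b = perm_act X g a" using maximal_unique gh by blast
  have "f = (Some \<circ> compose X (inv\<^bsub>BijGroup X\<^esub> h) g) |` Y"
  proof
    fix y
    show "f y = ((Some \<circ> compose X (inv\<^bsub>BijGroup X\<^esub> h) g) |` Y) y"
    proof (cases "y \<in> Y")
      case True
      then obtain z where z: "f y = Some z" by (auto simp: Y_def)
      have zX: "z \<in> X" using z ran_subset[OF f] by (auto simp: ran_def)
      have yX: "y \<in> X" using True YX by blast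
      have "Poly_Mapping.lookup b z = Poly_Mapping.lookup a y"
        unfolding b_def using inj_on_dom[OF f] keys z by (intro lookup_act) (simp_all add: Y_def)
      then have 1: "Poly_Mapping.lookup (perm_act X g a) (h z) = Poly_Mapping.lookup a y"
        using lookup_perm_act[OF hB bX zX] eq by simp
      obtain x where x: "x \<in> X" "g x = h z" using Bij_surj[OF gB Bij_mem[OF hB zX]] by blast
      then have "Poly_Mapping.lookup a x = Poly_Mapping.lookup a y"
        using 1 lookup_perm_act[OF gB aX x(1)] by simp
      \<comment> \<open>The exponent of \<open>y\<close> is positive, so \<open>x\<close> lies in
        \<open>Y\<close> as well, where the exponents are distinct.\<close>
      then have "x = y" using True e by (auto simp: al inj_on_eq_iff split: if_splits)
      then have "(inv\<^bsub>BijGroup X\<^esub> h) (g y) = z" using x inv_BijGroup(2)[OF hB zX] by simp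
      then show ?thesis using z True yX by (simp add: compose_eq)
    next
      case False
      then show ?thesis by (auto simp: Y_def)
    qed
  qed
  moreover have "compose X (inv\<^bsub>BijGroup X\<^esub> h) g \<in> full_perms"
    using gh full_perms_inv full_perms_compose by blast
  ultimately show "f \<in> restrictions X full_perms" using YX by (auto simp: restrictions_def)
qed

text \<open>
  Otherwise there would be a first point \<open>p\<^sup>aq\<^sup>b\<close> (with respect to the slope \<open>b / a\<close>) whose
  maximizing permutation lies in the wrong coset; the minimal slope is attained because \<open>M\<close> is
  finitely generated.  But that point is approached by points of the right coset, whose cone is
  closed.
\<close>

lemma segment_same_coset:
  assumes p: "p \<in> monomials X" and q: "q \<in> monomials X"
    and inj: "inj_on (Poly_Mapping.lookup p) (X - {i})"
    and pq: "\<And>l. l \<in> X - {i} \<Longrightarrow> Poly_Mapping.lookup q l = Poly_Mapping.lookup p l"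
    and g: "g \<in> full_perms" "perm_act X g p \<in> M" and h: "h \<in> full_perms" "perm_act X h q \<in> M"
  shows "same_coset g h"
proof -
  define x where "x a b = monomial_power a p + monomial_power b q" for a b
  have xX: "x a b \<in> monomials X" for a b using p q by (simp add: x_def monomial_power_monomials)
  have xl: "Poly_Mapping.lookup (x a b) l = a * Poly_Mapping.lookup p l + b * Poly_Mapping.lookup q l" for a b l
    by (simp add: x_def lookup_add lookup_monomial_power)
  have x_diff: "w = x (a' - a) (b' - b)" if "x a' b' = x a b + w" "a \<le> a'" "b \<le> b'" for a b a' b' w
  proof (rule poly_mapping_eqI)
    fix l
    have "Poly_Mapping.lookup (x a' b') l = Poly_Mapping.lookup (x a b) l + Poly_Mapping.lookup w l"
      using that(1) by (simp add: lookup_add)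
    moreover have "a * Poly_Mapping.lookup p l \<le> a' * Poly_Mapping.lookup p l"
      "b * Poly_Mapping.lookup q l \<le> b' * Poly_Mapping.lookup q l"
      using that(2,3) by simp_all
    ultimately show "Poly_Mapping.lookup w l = Poly_Mapping.lookup (x (a' - a) (b' - b)) l"
      by (simp add: xl diff_mult_distrib)
  qed
  \<comment> \<open>Away from \<open>i\<close> the two monomials agree, so the exponents of
    \<open>x a b\<close> are those of \<open>p\<close> multiplied by \<open>a + b\<close>.\<close>
  have x_inj: "inj_on (Poly_Mapping.lookup (x a b)) (X - {i})" if "a + b > 0" for a b
  proof (rule inj_onI)
    fix l l' assume l: "l \<in> X - {i}" "l' \<in> X - {i}"
      and "Poly_Mapping.lookup (x a b) l = Poly_Mapping.lookup (x a b) l'"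
    then have "(a + b) * Poly_Mapping.lookup p l = (a + b) * Poly_Mapping.lookup p l'"
      unfolding xl pq[OF l(1)] pq[OF l(2)] by (simp add: distrib_right)
    then show "l = l'" using that inj_onD[OF inj _ l] by auto
  qed
  define bad where "bad a b \<longleftrightarrow> a + b > 0 \<and>
    (\<exists>k\<in>full_perms. perm_act X k (x a b) \<in> M \<and> \<not> same_coset g k)" for a b
  \<comment> \<open>All permutations maximizing \<open>x a b\<close> lie in one coset by
    \<open>maximal_same_coset\<close>, so a single wrong one makes all of them wrong.\<close>
  have bad_all: "\<not> same_coset g k"
    if bad: "bad a b" and k: "k \<in> full_perms" "perm_act X k (x a b) \<in> M" for a b k
  proof
    assume gk: "same_coset g k"
    obtain k' where k': "k' \<in> full_perms" "perm_act X k' (x a b) \<in> M" "\<not> same_coset g k'" "a + b > 0"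
      using bad by (auto simp: bad_def)
    have "same_coset k k'"
      by (rule maximal_same_coset[OF k(1) k'(1) xX k(2) k'(2) x_inj[OF k'(4)]])
    then show False using same_coset_trans[OF g(1) k(1) k'(1) gk] k'(3) by blast
  qed
  have not_bad_0: "\<not> bad a 0" for a
  proof
    assume b: "bad a 0"
    have "x a 0 = monomial_power a p" by (intro poly_mapping_eqI) (simp add: xl lookup_monomial_power)
    then have m: "perm_act X g (x a 0) \<in> M"
      using perm_act_monomial_power[OF full_perms_Bij[OF g(1)] p] maximal_power[OF g(2)] by simp
    have "same_coset g g"
      by (rule maximal_same_coset[OF g(1) g(1) p g(2) g(2) inj])
    then show False using bad_all[OF b g(1) m] by blast
  qed
  have "\<not> bad 0 1"
  proof
    assume bad01: "bad 0 1"
    \<comment> \<open>The comparison of the slopes \<open>snd v / fst v\<close> is multiplied out,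
      which also covers the infinite slope of (0, 1).\<close>
    define steeper :: "nat \<times> nat \<Rightarrow> nat \<times> nat \<Rightarrow> bool"
      where "steeper v v' \<longleftrightarrow> snd v' * fst v < snd v * fst v'" for v v'
    define badv where "badv v \<longleftrightarrow> bad (fst v) (snd v)" for v
    have st_trans: "steeper u w" if "steeper u v" "steeper v w" for u v w
    proof -
      have pos: "fst v > 0" "fst w > 0" using that by (auto simp: steeper_def intro: gr0I)
      have "(snd w * fst u) * fst v \<le> (snd v * fst w) * fst u"
        using mult_le_mono1[of "snd w * fst v" "snd v * fst w" "fst u"] that(2)
        by (simp add: steeper_def ac_simps)
      also have "\<dots> = (snd v * fst u) * fst w" by (simp add: ac_simps)
      also have "\<dots> < (snd u * fst v) * fst w" using that(1) pos by (simp add: steeper_def)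
      also have "\<dots> = (snd u * fst w) * fst v" by (simp add: ac_simps)
      finally show ?thesis by (simp add: steeper_def)
    qed
    \<comment> \<open>If no bad point had minimal slope, there would be an infinite sequence of bad
      points with decreasing slopes, each chosen with least coordinate sum among the bad points less
      steep than its predecessor. The difference \<open>d\<close> of two of them, provided by
      \<open>good_pair\<close>, is then a bad point that contradicts this choice.\<close>
    have "\<exists>v. badv v \<and> (\<forall>w. badv w \<longrightarrow> \<not> steeper v w)"
    proof (rule ccontr)
      assume "\<not> ?thesis"
      then have ex: "\<exists>w. badv w \<and> steeper v w" if "badv v" for v using that by blast
      have least: "\<exists>w. badv w \<and> steeper v w \<and>
          (\<forall>w'. badv w' \<and> steeper v w' \<longrightarrow> fst w + snd w \<le> fst w' + snd w')" if "badv v" for v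
        using ex[OF that] ex_has_least_nat[of "\<lambda>w. badv w \<and> steeper v w" _ "\<lambda>w. fst w + snd w"]
        by blast
      obtain V where V: "\<And>n. badv (V n)" "\<And>n. steeper (V n) (V (Suc n))"
        "\<And>n w. badv w \<Longrightarrow> steeper (V n) w \<Longrightarrow> fst (V (Suc n)) + snd (V (Suc n)) \<le> fst w + snd w"
      proof -
        have "\<exists>V. \<forall>n. badv (V n) \<and> (steeper (V n) (V (Suc n)) \<and>
          (\<forall>w. badv w \<and> steeper (V n) w \<longrightarrow> fst (V (Suc n)) + snd (V (Suc n)) \<le> fst w + snd w))"
          by (rule dependent_nat_choice[where P = "\<lambda>_. badv"])
            (use bad01 least in \<open>auto simp: badv_def\<close>)
        then show thesis using that by blast
      qed
      have st: "steeper (V n) (V n')" if "n < n'" for n n'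
        using that
      proof (induction rule: less_Suc_induct)
        case (2 i j k)
        then show ?case using st_trans by blast
      qed (rule V)
      have "\<forall>n. \<exists>k. k \<in> full_perms \<and> perm_act X k (x (fst (V n)) (snd (V n))) \<in> M"
        using maximal_perm_exists xX by blast
      then obtain k where k: "\<And>n. k n \<in> full_perms"
        "\<And>n. perm_act X (k n) (x (fst (V n)) (snd (V n))) \<in> M" by metis
      obtain n n' w where w: "n < n'"
        "\<forall>f\<in>{\<lambda>n. fst (V n), \<lambda>n. snd (V n)}. f n \<le> f n'"
        "x (fst (V n')) (snd (V n')) = x (fst (V n)) (snd (V n)) + w"
        "k n' = k n" "perm_act X (k n') w \<in> M"
        using good_pair[of k "\<lambda>n. x (fst (V n)) (snd (V n))" "{\<lambda>n. fst (V n), \<lambda>n. snd (V n)}"] k xX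
        by auto
      have le: "fst (V n) \<le> fst (V n')" "snd (V n) \<le> snd (V n')" using w(2) by auto
      define d where "d = (fst (V n') - fst (V n), snd (V n') - snd (V n))"
      have wd: "w = x (fst d) (snd d)" using x_diff[OF w(3) le] by (simp add: d_def)
      \<comment> \<open>The vector \<open>V n'\<close> is the sum of \<open>V n\<close> and
        \<open>d\<close>, so its slope lies between theirs.\<close>
      have st_d: "steeper (V n') d"
      proof -
        have "steeper (V n) (V n')" using st w(1) by blast
        moreover obtain c e where "fst (V n') = fst (V n) + c" "snd (V n') = snd (V n) + e"
          using le by (metis le_Suc_ex)
        ultimately show ?thesis by (simp add: steeper_def d_def algebra_simps)
      qed
      have "fst d + snd d > 0"
        using st_d by (intro gr0I) (simp add: steeper_def)
      moreover have "\<not> same_coset g (k n')"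
        using bad_all V(1)[of n'] k by (simp add: badv_def)
      ultimately have bad_d: "badv d" using w(5) wd k(1) by (auto simp: badv_def bad_def)
      \<comment> \<open>The point \<open>d\<close> competes with \<open>V n'\<close> in the choice
        made after \<open>V l\<close>, but its coordinate sum is smaller by that of
        \<open>V n\<close>, which is positive.\<close>
      obtain l where l: "n' = Suc l" using w(1) by (cases n') auto
      have "steeper (V l) d" using V(2)[of l] st_d st_trans l by blast
      then have "fst (V n') + snd (V n') \<le> fst d + snd d" using V(3) bad_d l by blast
      moreover have "fst (V n) + snd (V n) > 0" using V(1)[of n] by (simp add: badv_def bad_def)
      ultimately show False using le unfolding d_def fst_conv snd_conv by linarith
    qed
    then obtain a b where ab: "bad a b" and min: "\<And>a' b'. bad a' b' \<Longrightarrow> \<not> b' * a < b * a'"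
      by (auto simp: badv_def steeper_def)
    have b: "b > 0" using ab not_bad_0 by (cases b) auto
    \<comment> \<open>The extra 1 makes the slope strictly smaller than \<open>b / a\<close>, so
      these points are not bad, while their slopes tend to \<open>b / a\<close>.\<close>
    have "\<forall>n. \<exists>k. k \<in> full_perms \<and> perm_act X k (x (n * a + 1) (n * b)) \<in> M"
      using maximal_perm_exists xX by blast
    then obtain k where k: "\<And>n. k n \<in> full_perms" "\<And>n. perm_act X (k n) (x (n * a + 1) (n * b)) \<in> M"
      by metis
    have good: "same_coset g (k n)" for n
    proof (rule ccontr)
      assume "\<not> same_coset g (k n)"
      then have "bad (n * a + 1) (n * b)" using k by (auto simp: bad_def)
      then show False using min b by (force simp: algebra_simps)
    qed
    obtain n n' w where w: "n < n'" "x (n' * a + 1) (n' * b) = x (n * a + 1) (n * b) + w"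
      "perm_act X (k n') w \<in> M"
      using good_pair[of k "\<lambda>n. x (n * a + 1) (n * b)" "{}"] k xX by auto
    \<comment> \<open>In the difference the extra 1 cancels, leaving a power of the bad point
      \<open>x a b\<close>. It is maximized by a permutation in the right coset.\<close>
    have "w = x ((n' - n) * a) ((n' - n) * b)"
      using x_diff[OF w(2)] w(1) by (simp add: diff_mult_distrib)
    also have "\<dots> = monomial_power (n' - n) (x a b)"
      by (intro poly_mapping_eqI) (simp add: xl lookup_monomial_power algebra_simps)
    finally have "monomial_power (n' - n) (perm_act X (k n') (x a b)) \<in> M"
      using w(3) perm_act_monomial_power[OF full_perms_Bij[OF k(1)] xX] by simp
    then have "perm_act X (k n') (x a b) \<in> M"
      using maximal_power_cancel[of "n' - n"] w(1) perm_act_monomials[OF full_perms_Bij[OF k(1)] xX] by simp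
    then show False using bad_all[OF ab k(1)] good by blast
  qed
  moreover have "x 0 1 = q" by (intro poly_mapping_eqI) (simp add: xl)
  ultimately show ?thesis using h by (auto simp: bad_def)
qed

text \<open>The exponents of \<open>p\<close> are replaced by those of \<open>q\<close> one variable
  at a time. As all exponents of \<open>q\<close> exceed all those of \<open>p\<close>, every
  mixture has distinct exponents, so \<open>segment_same_coset\<close> applies to each
  replacement.\<close>

lemma same_coset_of_greater:
  assumes p: "p \<in> monomials X" "inj_on (Poly_Mapping.lookup p) X"
    and q: "q \<in> monomials X" "inj_on (Poly_Mapping.lookup q) X"
    and pq: "\<And>i j. i \<in> X \<Longrightarrow> j \<in> X \<Longrightarrow> Poly_Mapping.lookup p i < Poly_Mapping.lookup q j"
    and g: "g \<in> full_perms" "perm_act X g p \<in> M" and h: "h \<in> full_perms" "perm_act X h q \<in> M"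
  shows "same_coset g h"
proof -
  define mix where "mix W = monomial_of X
    (\<lambda>i. if i \<in> W then Poly_Mapping.lookup q i else Poly_Mapping.lookup p i)" for W
  have mixl: "Poly_Mapping.lookup (mix W) i =
    (if i \<in> W then Poly_Mapping.lookup q i else Poly_Mapping.lookup p i)" if "i \<in> X" for W i
    using that by (simp add: mix_def lookup_monomial_of finite_X)
  have mixX: "mix W \<in> monomials X" for W
    unfolding mix_def using finite_X by (rule monomial_of_monomials) simp
  have mix_inj: "inj_on (Poly_Mapping.lookup (mix W)) X" for W
  proof (rule inj_onI)
    fix i j assume ij: "i \<in> X" "j \<in> X" "Poly_Mapping.lookup (mix W) i = Poly_Mapping.lookup (mix W) j"
    then show "i = j"
      using pq[OF ij(1,2)] pq[OF ij(2,1)] inj_onD[OF p(2) _ ij(1,2)] inj_onD[OF q(2) _ ij(1,2)]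
      by (auto simp: mixl split: if_splits)
  qed
  have "same_coset g k" if "finite W" "W \<subseteq> X" "k \<in> full_perms" "perm_act X k (mix W) \<in> M" for W k
    using that
  proof (induction arbitrary: k rule: finite_induct)
    case empty
    have "mix {} = p" by (rule monomials_eqI[OF mixX p(1)]) (simp add: mixl)
    then show ?case
      using empty maximal_same_coset[OF g(1) _ p(1) g(2), of k i] inj_on_subset[OF p(2)] by auto
  next
    case (insert i W)
    obtain k' where k': "k' \<in> full_perms" "perm_act X k' (mix W) \<in> M"
      using maximal_perm_exists[OF mixX] by blast
    then have "same_coset g k'" using insert by blast
    moreover have "same_coset k' k"
    proof (rule segment_same_coset[OF mixX mixX _ _ k' insert.prems(2,3)])
      show "inj_on (Poly_Mapping.lookup (mix W)) (X - {i})" using mix_inj by (rule inj_on_subset) auto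
      show "Poly_Mapping.lookup (mix (insert i W)) l = Poly_Mapping.lookup (mix W) l"
        if "l \<in> X - {i}" for l using that by (simp add: mixl)
    qed
    ultimately show ?case using same_coset_trans g(1) k'(1) insert.prems(2) by blast
  qed
  moreover have "mix X = q" by (rule monomials_eqI[OF mixX q(1)]) (simp add: mixl)
  ultimately show ?thesis using finite_X h by auto
qed

text \<open>Let \<open>p\<close> have distinct exponents and let \<open>g\<close> maximize
  \<open>p\<close>. Then \<open>g\<close> after the inverse of \<open>k\<close> maximizes every
  power of the image \<open>kp\<close> of \<open>p\<close> under \<open>k\<close>. For a power
  exceeding \<open>p\<close> both permutations lie in one coset, which puts the inverse of
  \<open>k\<close> into the group.\<close>

lemma full_perms_eq_transposition_group: "full_perms = transposition_group"
proof (intro equalityI subsetI)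
  fix k assume k: "k \<in> full_perms"
  interpret group "BijGroup X" by (rule group_BijGroup)
  have kB: "k \<in> Bij X" using k by (rule full_perms_Bij)
  note iB = inv_BijGroup(1)[OF kB]
  obtain e :: "'a \<Rightarrow> nat" where e: "inj_on e X"
    using finite_imp_inj_to_nat_seg[OF finite_X] by blast
  define p where "p = monomial_of X (Suc \<circ> e)"
  have pl: "Poly_Mapping.lookup p i = Suc (e i)" if "i \<in> X" for i
    using that by (simp add: p_def lookup_monomial_of finite_X)
  have p: "p \<in> monomials X" "inj_on (Poly_Mapping.lookup p) X"
    using finite_X e by (auto simp: p_def monomial_of_monomials inj_on_def lookup_monomial_of)
  obtain g where g: "g \<in> full_perms" "perm_act X g p \<in> M" using maximal_perm_exists[OF p(1)] by blast
  have gB: "g \<in> Bij X" using g(1) by (rule full_perms_Bij)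
  \<comment> \<open>\<open>N\<close> exceeds all exponents of \<open>p\<close>. Those of
    \<open>kp\<close> are at least 1, so the exponents of its \<open>N\<close>-th power are at least
    \<open>N\<close>.\<close>
  define N where "N = Suc (\<Sum>i\<in>X. Poly_Mapping.lookup p i)"
  have N_pos: "N > 0" by (simp add: N_def)
  have N: "Poly_Mapping.lookup p i < N" if "i \<in> X" for i
    using member_le_sum[OF that, of "Poly_Mapping.lookup p"] finite_X by (simp add: N_def)
  define kp where "kp = perm_act X k p"
  have kpX: "kp \<in> monomials X" unfolding kp_def using kB p(1) by (rule perm_act_monomials)
  have kpl: "\<exists>j\<in>X. i = k j \<and> Poly_Mapping.lookup kp i = Poly_Mapping.lookup p j" if i: "i \<in> X" for i
    using Bij_surj[OF kB i] lookup_perm_act[OF kB p(1)] unfolding kp_def by metis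
  have "same_coset g (compose X g (inv\<^bsub>BijGroup X\<^esub> k))"
  proof (rule same_coset_of_greater[OF p _ _ _ g])
    show "monomial_power N kp \<in> monomials X" using kpX by (rule monomial_power_monomials)
    show "inj_on (Poly_Mapping.lookup (monomial_power N kp)) X"
    proof (rule inj_onI)
      fix i i' assume i: "i \<in> X" "i' \<in> X"
        "Poly_Mapping.lookup (monomial_power N kp) i = Poly_Mapping.lookup (monomial_power N kp) i'"
      then have "Poly_Mapping.lookup kp i = Poly_Mapping.lookup kp i'"
        using N_pos by (simp add: lookup_monomial_power)
      then show "i = i'" using kpl[OF i(1)] kpl[OF i(2)] p(2) by (auto dest: inj_onD)
    qed
    show "Poly_Mapping.lookup p i < Poly_Mapping.lookup (monomial_power N kp) j"
      if ij: "i \<in> X" "j \<in> X" for i j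
    proof -
      obtain j' where "j' \<in> X" "Poly_Mapping.lookup kp j = Poly_Mapping.lookup p j'"
        using kpl[OF ij(2)] by blast
      then show ?thesis using N[OF ij(1)] pl by (simp add: lookup_monomial_power)
    qed
    show "compose X g (inv\<^bsub>BijGroup X\<^esub> k) \<in> full_perms"
      using g(1) k full_perms_compose full_perms_inv by blast
    have "perm_act X (compose X g (inv\<^bsub>BijGroup X\<^esub> k)) kp = perm_act X g p"
      using perm_act_compose[OF gB iB kpX] perm_act_inv(1)[OF kB p(1)] by (simp add: kp_def)
    then show "perm_act X (compose X g (inv\<^bsub>BijGroup X\<^esub> k)) (monomial_power N kp) \<in> M"
      using perm_act_monomial_power[OF compose_Bij[OF gB iB] kpX] maximal_power[OF g(2)] by simp
  qed
  moreover have "inv\<^bsub>BijGroup X\<^esub> g \<otimes>\<^bsub>BijGroup X\<^esub> compose X g (inv\<^bsub>BijGroup X\<^esub> k) = inv\<^bsub>BijGroup X\<^esub> k"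
    using gB iB by (metis carrier_BijGroup mult_BijGroup inv_closed l_inv l_one m_assoc)
  ultimately have "inv\<^bsub>BijGroup X\<^esub> k \<in> transposition_group" by (simp add: same_coset_def)
  then show "k \<in> transposition_group"
    using subgroup.m_inv_closed[OF subgroup_transposition_group] kB
    by (metis carrier_BijGroup inv_inv)
qed (use transposition_group_subset in blast)

end

theorem theorem9:
  fixes X :: "'a set"
    and G :: "('a \<rightharpoonup> 'a) set"
    and r :: "'a monomial rel"
  assumes "finite X"
    and "permutation_groupoid X G"
    and "admissible_order X r"
  shows "(\<exists>B :: ('a, 'k::field) mpoly set. finite B \<and> sagbi_basis r (invariant_ring X G) B) \<longleftrightarrow>
    (\<exists>H. subgroup H (BijGroup X) \<and> generated_by_transpositions X H \<and> G = restrictions X H)"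
proof -
  interpret ordered_perm_groupoid X G r using assms by unfold_locales
  show ?thesis unfolding finite_sagbi_basis_iff
  proof
    assume "\<exists>S. finite S \<and> monoid_generated S = M"
    then obtain S where "finite S" "monoid_generated S = M" by blast
    then interpret finitely_generated_maximal X G r S by unfold_locales
    have "generated_by_transpositions X transposition_group"
      unfolding generated_by_transpositions_def transposition_group_def by blast
    then show "\<exists>H. subgroup H (BijGroup X) \<and> generated_by_transpositions X H \<and> G = restrictions X H"
      using subgroup_transposition_group groupoid_eq_restrictions full_perms_eq_transposition_group
      by auto
  next
    assume "\<exists>H. subgroup H (BijGroup X) \<and> generated_by_transpositions X H \<and> G = restrictions X H"
    then show "\<exists>S. finite S \<and> monoid_generated S = M"
      using generated_by_transpositions_finitely_generated by blast
  qed
qed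

end
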